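(* Let $G$ be a finite group. Then $G$ is autonilpotent if and only if $N_{\mathrm{Aut}\,G}(P)/C_{\mathrm{Aut}\,G}(P)$ is a $p$-group for every $p\in\pi(G)$ and every $p$-subgroup $P$ of $G$.
   Context: All groups are finite. $\pi(G)$ is the set of prime divisors of $|G|$. $\mathrm{Aut}\,G$ is the group of all automorphisms of $G$. For $x\in G$ and $\alpha\in\mathrm{Aut}\,G$, $x^\alpha$ denotes the image of $x$ under $\alpha$. For a subgroup $P$ of $G$, $N_{\mathrm{Aut}\,G}(P)=\{\alpha\in\mathrm{Aut}\,G\mid P^\alpha=P\}$ and $C_{\mathrm{Aut}\,G}(P)=\{\alpha\in\mathrm{Aut}\,G\mid x^\alpha=x \text{ for all } x\in P\}$. Put $[x,\alpha]=x^{-1}x^\alpha$ and inductively $[x,\alpha_1,\dots,\alpha_n]=[[x,\alpha_1,\dots,\alpha_{n-1}],\alpha_n]$. For a natural number $n$ let $L_n(G)=\{x\in G \mid [x,\alpha_1,\dots,\alpha_n]=1 \text{ for all } \alpha_1,\dots,\alpha_n\in\mathrm{Aut}\,G\}$. The group $G$ is called autonilpotent if $G=L_n(G)$ for some natural number $n$. *)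

theory Defs
  imports "HOL-Algebra.Coset" "HOL-Algebra.Bij" "HOL-Computational_Algebra.Primes"
begin

definition group_primes :: "('a, 'b) monoid_scheme \<Rightarrow> nat set" where
  "group_primes G = prime_factors (order G)"

text \<open>For prime \<open>p\<close>, the order condition forces the carrier to be finite, since \<^const>\<open>order\<close> is
  \<open>0\<close> on infinite carriers. The trivial group is a \<open>p\<close>-group (\<open>k = 0\<close>).\<close>
definition p_group :: "nat \<Rightarrow> ('a, 'b) monoid_scheme \<Rightarrow> bool" where
  "p_group p H \<longleftrightarrow> prime p \<and> group H \<and> (\<exists>k. order H = p ^ k)"

definition p_subgroup :: "nat \<Rightarrow> 'a set \<Rightarrow> ('a, 'b) monoid_scheme \<Rightarrow> bool" where
  "p_subgroup p P G \<longleftrightarrow> subgroup P G \<and> p_group p (G\<lparr>carrier := P\<rparr>)"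

text \<open>The image \<open>x\<^sup>\<alpha>\<close> is written \<open>\<alpha> x\<close>, so the product in \<^const>\<open>AutoGroup\<close> is composition of maps
  acting on the left, opposite to the exponent convention. Inversion is an isomorphism between
  the two groups and preserves the subgroups below.\<close>
definition aut_normalizer :: "('a, 'b) monoid_scheme \<Rightarrow> 'a set \<Rightarrow> ('a \<Rightarrow> 'a) set" where
  "aut_normalizer G P = {\<alpha> \<in> carrier (AutoGroup G). \<alpha> ` P = P}"

definition aut_centralizer :: "('a, 'b) monoid_scheme \<Rightarrow> 'a set \<Rightarrow> ('a \<Rightarrow> 'a) set" where
  "aut_centralizer G P = {\<alpha> \<in> carrier (AutoGroup G). \<forall>x\<in>P. \<alpha> x = x}"

definition autocommutator :: "('a, 'b) monoid_scheme \<Rightarrow> 'a \<Rightarrow> ('a \<Rightarrow> 'a) \<Rightarrow> 'a" where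
  "autocommutator G x \<alpha> = inv\<^bsub>G\<^esub> x \<otimes>\<^bsub>G\<^esub> \<alpha> x"

text \<open>Left-normed: \<open>[x, \<alpha>\<^sub>1, \<dots>, \<alpha>\<^sub>n] = [[x, \<alpha>\<^sub>1, \<dots>, \<alpha>\<^sub>n\<^sub>-\<^sub>1], \<alpha>\<^sub>n]\<close>, and just \<open>x\<close> for the empty list.\<close>
definition iterated_autocommutator ::
    "('a, 'b) monoid_scheme \<Rightarrow> 'a \<Rightarrow> ('a \<Rightarrow> 'a) list \<Rightarrow> 'a" where
  "iterated_autocommutator G x \<alpha>s = foldl (autocommutator G) x \<alpha>s"

definition autocentral_term :: "nat \<Rightarrow> ('a, 'b) monoid_scheme \<Rightarrow> 'a set" where
  "autocentral_term n G =
     {x \<in> carrier G. \<forall>\<alpha>s. length \<alpha>s = n \<and> set \<alpha>s \<subseteq> carrier (AutoGroup G) \<longrightarrow>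
        iterated_autocommutator G x \<alpha>s = \<one>\<^bsub>G\<^esub>}"

text \<open>Allowing \<open>n = 0\<close> changes nothing: that term is the trivial subgroup, and the trivial
  group already coincides with its term for \<open>n = 1\<close>.\<close>
definition autonilpotent :: "('a, 'b) monoid_scheme \<Rightarrow> bool" where
  "autonilpotent G \<longleftrightarrow> (\<exists>n. carrier G = autocentral_term n G)"

end

theory Submission
  imports Defs "HOL-Algebra.Group_Action" "HOL-Algebra.Sylow" "HOL-Algebra.Multiplicative_Group"
begin

text \<open>Write \<open>A\<close> for the automorphism group of \<open>G\<close>, and call an element a \<open>p\<close>-element if its order is a
power of \<open>p\<close>.

If \<open>G\<close> is autonilpotent, take \<open>\<alpha>\<close> in \<open>A\<close> normalizing a \<open>p\<close>-subgroup \<open>P\<close>, and let \<open>\<beta>\<close> be a power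
\<open>\<alpha> ^ (p ^ k)\<close> whose order \<open>m\<close> is prime to \<open>p\<close>. If \<open>y = [x, \<beta>]\<close> is fixed by \<open>\<beta>\<close>, then
\<open>\<beta> ^ m\<close> maps \<open>x\<close> to \<open>x y ^ m\<close>, so \<open>y ^ m = 1\<close>; for \<open>x\<close> in \<open>P\<close> also \<open>y\<close> lies in \<open>P\<close>, and \<open>y = 1\<close>.
Climbing the autocentral series with this observation
(\<open>coprime_order_fixes_central_term\<close>) shows that \<open>\<beta>\<close> centralizes \<open>P\<close>. Hence every element of
\<open>N(P) / C(P)\<close> is a \<open>p\<close>-element, and by Cauchy's theorem the quotient is a \<open>p\<close>-group.

For the converse the hypothesis is used in the form: an automorphism of order a power of a prime
\<open>q \<noteq> p\<close> that leaves a \<open>p\<close>-subgroup invariant fixes it pointwise. Suppose first that the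
\<open>p\<close>-elements of \<open>G\<close> form a subgroup for each prime \<open>p\<close>. As long as a term \<open>L\<close> of the autocentral
series is not all of \<open>G\<close>, some such subgroup \<open>P\<close> is not contained in \<open>L\<close>, and \<open>A\<close> permutes the
cosets of \<open>L \<inter> P\<close> in \<open>P\<close>. Since elements of order prime to \<open>p\<close> act trivially, orbits have
\<open>p\<close>-power size, so the number of fixed cosets is divisible by \<open>p\<close>; a fixed coset other than the
trivial one lies in the next term. So the series grows until it reaches \<open>G\<close>
(\<open>central_term_eq_carrier\<close>).

It remains to see that \<open>G\<close> is nilpotent, and here only inner automorphisms are needed: a group in
which \<open>q\<close>-elements normalizing a \<open>p\<close>-subgroup centralize it is nilpotent
(\<open>coprime_commuting_of_p_local_centralizing\<close>). This is a weak form of the Frobenius theorem on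
normal \<open>p\<close>-complements, and because all primes are treated at once it needs no transfer. By
induction all proper subgroups are nilpotent. Schmidt's counting argument
(\<open>exists_normal_maximal_subgroup\<close>) then gives a normal maximal subgroup \<open>M\<close>. Its \<open>p\<close>-elements
form a subgroup normal in \<open>G\<close>, so they commute with all \<open>q\<close>-elements of \<open>G\<close>; and two elements of
coprime prime power orders cannot both lie outside \<open>M\<close>.

The central series is set up for an arbitrary group acting on \<open>G\<close> through automorphisms that
include the inner ones. With \<open>A\<close> acting it is the autocentral series; with \<open>G\<close> acting by
conjugation it is the upper central series, which supplies the normalizer condition used in
Schmidt's argument.\<close>

section \<open>Elements of prime power order\<close>

definition p_elements :: "nat \<Rightarrow> ('a, 'b) monoid_scheme \<Rightarrow> 'a set" where
  "p_elements p G = {x \<in> carrier G. \<exists>k. x [^]\<^bsub>G\<^esub> (p ^ k) = \<one>\<^bsub>G\<^esub>}"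

lemma p_elements_subgroup:
  assumes "subgroup H G"
  shows "p_elements p (G\<lparr>carrier := H\<rparr>) = p_elements p G \<inter> H"
  using subgroup.subset[OF assms] by (auto simp: p_elements_def nat_pow_def)

lemma (in group) subgroup_nat_pow_closed:
  assumes "subgroup H G" "x \<in> H"
  shows "x [^] (n::nat) \<in> H"
  using assms by (induction n) (auto simp: subgroup.one_closed subgroup.m_closed)

text \<open>By Bezout, \<open>x\<close> is a product of powers of \<open>x [^] a\<close> and \<open>x [^] b\<close>.\<close>
lemma (in group) mem_of_coprime_powers:
  fixes a b :: nat
  assumes H: "subgroup H G" and x: "x \<in> carrier G"
    and a: "x [^] a \<in> H" and b: "x [^] b \<in> H" and "coprime a b"
  shows "x \<in> H"
proof -
  obtain u v where "u * int a + v * int b = 1"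
    using bezout_int[of "int a" "int b"] \<open>coprime a b\<close> by auto
  then have "x = x [^] (int a * u + int b * v)"
    using x by (simp add: mult.commute)
  also have "\<dots> = (x [^] a) [^] u \<otimes> (x [^] b) [^] v"
    using x by (simp add: int_pow_mult int_pow_pow flip: int_pow_int)
  also have "\<dots> \<in> H"
    using H a b by (simp add: subgroup.m_closed subgroup_int_pow_closed)
  finally show ?thesis .
qed

lemma (in group) p_element_mem_of_coprime_power:
  assumes "subgroup H G" "x \<in> p_elements p G" "x [^] (m::nat) \<in> H" "coprime p m"
  shows "x \<in> H"
proof -
  obtain k where k: "x \<in> carrier G" "x [^] (p ^ k) = \<one>"
    using assms(2) by (auto simp: p_elements_def)
  show ?thesis
    by (rule mem_of_coprime_powers[OF assms(1) k(1), of "p ^ k" m])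
       (use assms k in \<open>auto simp: subgroup.one_closed\<close>)
qed

lemma (in group) p_element_eq_one_of_coprime_power:
  assumes "x \<in> p_elements p G" "x [^] (m::nat) = \<one>" "coprime p m"
  shows "x = \<one>"
  using p_element_mem_of_coprime_power[OF triv_subgroup assms(1) _ assms(3)] assms(2) by simp

lemma (in group) subgroup_card_prime_power_p_elements:
  assumes "subgroup H G" "card H = p ^ k" "prime p"
  shows "H \<subseteq> p_elements p G"
proof
  fix x assume x: "x \<in> H"
  interpret H: group "G\<lparr>carrier := H\<rparr>" using assms(1) by (rule subgroup_imp_group)
  have "x [^] (card H) = \<one>"
    using H.pow_order_eq_1[of x] x by (simp add: order_def nat_pow_def)
  then have "x [^] (p ^ k) = \<one>" by (simp only: assms(2))
  moreover have "x \<in> carrier G" using x subgroup.subset[OF assms(1)] by blast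
  ultimately show "x \<in> p_elements p G" by (auto simp: p_elements_def)
qed

text \<open>A second prime divisor \<open>q\<close> of the order would, by Cauchy's theorem (Sylow's theorem for exponent
1), give a nontrivial element that is both a \<open>p\<close>-element and a \<open>q\<close>-element.\<close>
lemma (in group) order_prime_power_of_p_elements:
  assumes fin: "finite (carrier G)" and p: "prime p" and all: "carrier G \<subseteq> p_elements p G"
  shows "\<exists>k. order G = p ^ k"
proof -
  have pos: "order G > 0" using fin by (simp add: order_gt_0_iff_finite)
  have "q = p" if q: "prime q" "q dvd order G" for q
  proof (rule ccontr)
    assume "q \<noteq> p"
    obtain m where "order G = q ^ 1 * m" using q by auto
    then obtain H where H: "subgroup H G" "card H = q ^ 1"
      using sylow_thm q fin by (metis group_axioms)
    have "H \<subseteq> {\<one>}"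
    proof
      fix x assume "x \<in> H"
      with subgroup_card_prime_power_p_elements[OF H q(1)] obtain j
        where "x [^] (q ^ j) = \<one>" by (auto simp: p_elements_def)
      moreover have "x \<in> p_elements p G" using \<open>x \<in> H\<close> H all subgroup.subset by blast
      moreover have "coprime p (q ^ j)"
        using p q \<open>q \<noteq> p\<close> by (simp add: primes_coprime)
      ultimately show "x \<in> {\<one>}" using p_element_eq_one_of_coprime_power by blast
    qed
    then have "card H \<le> 1" using card_mono[of "{\<one>}" H] by simp
    moreover have "card H > 1" using H prime_gt_1_nat[OF q(1)] by simp
    ultimately show False by simp
  qed
  then have "prime_factors (order G) \<subseteq> {p}" by (auto simp: prime_factors_dvd)
  then have "prime_factors (order G) = {} \<or> prime_factors (order G) = {p}" by blast
  moreover have "order G = (\<Prod>q \<in> prime_factors (order G). q ^ multiplicity q (order G))"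
    using prime_factorization_nat pos by blast
  ultimately have "order G = p ^ 0 \<or> order G = p ^ multiplicity p (order G)" by fastforce
  then show ?thesis by blast
qed

text \<open>An element is a product of its primary components. They are split off one prime at a time: if
\<open>x\<close> has exponent \<open>p ^ k * m\<close>, then \<open>x [^] m\<close> is a \<open>p\<close>-element and \<open>x [^] (p ^ k)\<close> has the smaller
exponent \<open>m\<close>.\<close>
lemma (in group) eq_carrier_of_p_elements:
  assumes fin: "finite (carrier G)" and H: "subgroup H G"
    and sub: "\<And>p. prime p \<Longrightarrow> p_elements p G \<subseteq> H"
  shows "H = carrier G"
proof -
  have "x \<in> H" if "n > 0" "x \<in> carrier G" "x [^] n = \<one>" for n :: nat and x
    using that
  proof (induction n arbitrary: x rule: less_induct)
    case (less n)
    show ?case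
    proof (cases "n = 1")
      case True
      then show ?thesis using less.prems subgroup.one_closed[OF H] by simp
    next
      case False
      then obtain p where p: "prime p" "p dvd n" using prime_factor_nat by blast
      obtain k m where m: "n = p ^ k * m" "\<not> p dvd m"
        by (rule multiplicity_decompose'[of n p]) (use less.prems(1) not_prime_unit[of p] p(1) in auto)
      have k: "k > 0" using p(2) m by (cases k) auto
      have "m > 0" using m less.prems by (cases m) auto
      moreover have "m < n"
      proof -
        have "1 < p ^ k" using k prime_gt_1_nat[OF p(1)] by (rule one_less_power[rotated])
        then show ?thesis using m \<open>m > 0\<close> by simp
      qed
      moreover have "(x [^] (p ^ k)) [^] m = \<one>"
        using less.prems m by (simp add: nat_pow_pow)
      ultimately have "x [^] (p ^ k) \<in> H"
        using less.IH[of m "x [^] (p ^ k)"] less.prems(2) nat_pow_closed by blast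
      moreover have "x [^] m \<in> H"
      proof -
        have "(x [^] m) [^] (p ^ k) = \<one>"
          using less.prems m by (simp add: nat_pow_pow mult.commute)
        then have "x [^] m \<in> p_elements p G" using less.prems by (auto simp: p_elements_def)
        then show ?thesis using sub p by blast
      qed
      moreover have "coprime (p ^ k) m" using p m prime_imp_coprime by auto
      ultimately show ?thesis using mem_of_coprime_powers[OF H] less.prems by blast
    qed
  qed
  then have "carrier G \<subseteq> H"
    using fin pow_order_eq_1 order_gt_0_iff_finite by blast
  then show ?thesis using subgroup.subset[OF H] by blast
qed

lemma (in normal) pow_index_mem:
  assumes "x \<in> carrier G"
  shows "x [^] (card (rcosets H)) \<in> H"
proof -
  interpret Q: group "G Mod H" by (rule factorgroup_is_group)
  have "H #> x \<in> carrier (G Mod H)" using assms by (auto simp: FactGroup_def RCOSETS_def)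
  then have "(H #> x) [^]\<^bsub>G Mod H\<^esub> order (G Mod H) = \<one>\<^bsub>G Mod H\<^esub>" by (rule Q.pow_order_eq_1)
  then have "H #> (x [^] order (G Mod H)) = H"
    using assms by (simp add: FactGroup_pow) 
  then show ?thesis
    using assms by (simp add: order_def FactGroup_def coset_join1 subgroup_axioms)
qed

lemma (in group) subgroup_card_dvd:
  assumes "subgroup H G" "subgroup K G" "H \<subseteq> K"
  shows "card H dvd card K"
proof -
  interpret K: group "G\<lparr>carrier := K\<rparr>" using assms(2) by (rule subgroup_imp_group)
  have "subgroup H (G\<lparr>carrier := K\<rparr>)" using assms by (simp add: subgroup_incl)
  from K.lagrange[OF this]
  have "card K = card (rcosets\<^bsub>G\<lparr>carrier := K\<rparr>\<^esub> H) * card H" by (simp add: order_def)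
  then show ?thesis by simp
qed

lemma (in group) exists_Sylow_subgroup:
  assumes "finite (carrier G)" "prime p"
  shows "\<exists>P. subgroup P G \<and> card P = p ^ multiplicity p (order G)"
proof -
  obtain m where "order G = p ^ multiplicity p (order G) * m" using multiplicity_dvd by blast
  then show ?thesis using sylow_thm assms by (metis group_axioms)
qed

section \<open>Fixed points of actions in which only one prime matters\<close>

lemma group_actionI:
  assumes "group \<Gamma>"
    and closed: "\<And>\<gamma> x. \<gamma> \<in> carrier \<Gamma> \<Longrightarrow> x \<in> E \<Longrightarrow> f \<gamma> x \<in> E"
    and one: "\<And>x. x \<in> E \<Longrightarrow> f \<one>\<^bsub>\<Gamma>\<^esub> x = x"
    and mult: "\<And>\<gamma> \<delta> x. \<gamma> \<in> carrier \<Gamma> \<Longrightarrow> \<delta> \<in> carrier \<Gamma> \<Longrightarrow> x \<in> E \<Longrightarrow>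
      f (\<gamma> \<otimes>\<^bsub>\<Gamma>\<^esub> \<delta>) x = f \<gamma> (f \<delta> x)"
  shows "group_action \<Gamma> E (\<lambda>\<gamma>. \<lambda>x\<in>E. f \<gamma> x)"
proof -
  interpret \<Gamma>: group \<Gamma> by fact
  have bij: "(\<lambda>x\<in>E. f \<gamma> x) \<in> Bij E" if \<gamma>: "\<gamma> \<in> carrier \<Gamma>" for \<gamma>
  proof -
    have "bij_betw (f \<gamma>) E E"
    proof (rule bij_betwI[of _ _ _ "f (inv\<^bsub>\<Gamma>\<^esub> \<gamma>)"])
      show "f (inv\<^bsub>\<Gamma>\<^esub> \<gamma>) (f \<gamma> x) = x" if "x \<in> E" for x
        using mult[of "inv\<^bsub>\<Gamma>\<^esub> \<gamma>" \<gamma> x] that \<gamma> one by simp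
      show "f \<gamma> (f (inv\<^bsub>\<Gamma>\<^esub> \<gamma>) x) = x" if "x \<in> E" for x
        using mult[of \<gamma> "inv\<^bsub>\<Gamma>\<^esub> \<gamma>" x] that \<gamma> one by simp
    qed (use closed \<gamma> in auto)
    then show ?thesis by (simp add: Bij_def bij_betw_restrict_eq cong: bij_betw_cong)
  qed
  have "(\<lambda>\<gamma>. \<lambda>x\<in>E. f \<gamma> x) \<in> hom \<Gamma> (BijGroup E)"
  proof (rule homI)
    fix \<gamma> \<delta> assume \<gamma>: "\<gamma> \<in> carrier \<Gamma>" and \<delta>: "\<delta> \<in> carrier \<Gamma>"
    show "(\<lambda>x\<in>E. f (\<gamma> \<otimes>\<^bsub>\<Gamma>\<^esub> \<delta>) x) = (\<lambda>x\<in>E. f \<gamma> x) \<otimes>\<^bsub>BijGroup E\<^esub> (\<lambda>x\<in>E. f \<delta> x)"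
      using \<gamma> \<delta> bij closed mult by (auto simp: BijGroup_def compose_def intro!: restrict_ext)
  qed (simp add: BijGroup_def bij)
  then show ?thesis
    using group_BijGroup \<Gamma>.group_axioms
    by (simp add: group_action_def group_hom_def group_hom_axioms_def)
qed

text \<open>The acting group need not be a \<open>p\<close>-group; it is enough that its \<open>q\<close>-elements with \<open>q \<noteq> p\<close> act
trivially. Then each stabilizer contains a Sylow \<open>q\<close>-subgroup for every such \<open>q\<close>, so \<open>p\<close> is the
only prime that can divide the length of an orbit.\<close>
lemma (in group_action) prime_dvd_card_fixed_points:
  assumes finG: "finite (carrier G)" and finE: "finite E" and p: "prime p"
    and triv: "\<And>q g x. prime q \<Longrightarrow> q \<noteq> p \<Longrightarrow> g \<in> p_elements q G \<Longrightarrow> x \<in> E \<Longrightarrow> \<phi> g x = x"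
    and dvd: "p dvd card E"
  shows "p dvd card {x \<in> E. \<forall>g \<in> carrier G. \<phi> g x = x}"
proof -
  interpret group G using group_hom group_hom.axioms(1) by auto
  let ?Fix = "{x \<in> E. \<forall>g \<in> carrier G. \<phi> g x = x}"
  have orb: "p dvd card (orbit G \<phi> x)" if x: "x \<in> E" "card (orbit G \<phi> x) \<noteq> 1" for x
  proof -
    obtain q where q: "prime q" "q dvd card (orbit G \<phi> x)"
      using x(2) prime_factor_nat by blast
    have S: "subgroup (stabilizer G \<phi> x) G" using x by (simp add: stabilizer_subgroup)
    have os: "card (orbit G \<phi> x) * card (stabilizer G \<phi> x) = order G"
      using orbit_stabilizer_theorem x by simp
    have "q = p"
    proof (rule ccontr)
      assume "q \<noteq> p"
      let ?b = "multiplicity q (order G)"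
      obtain Q where Q: "subgroup Q G" "card Q = q ^ ?b"
        using exists_Sylow_subgroup[OF finG q(1)] by blast
      have "Q \<subseteq> stabilizer G \<phi> x"
        using subgroup_card_prime_power_p_elements[OF Q q(1)] triv[OF q(1) \<open>q \<noteq> p\<close> _ x(1)]
        by (auto simp: stabilizer_def p_elements_def)
      then have "q ^ ?b dvd card (stabilizer G \<phi> x)"
        using subgroup_card_dvd[OF Q(1) S] Q(2) by simp
      with q(2) have "q * q ^ ?b dvd order G" using os mult_dvd_mono by metis
      then have "Suc ?b \<le> ?b"
        using q(1) finG order_gt_0_iff_finite by (intro multiplicity_geI) auto
      then show False by simp
    qed
    then show ?thesis using q by simp
  qed
  \<comment> \<open>Summing over orbits counts the points that are not fixed; each orbit contributes \<open>0\<close> or a multiple of \<open>p\<close>.\<close>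
  define f where "f x = (if x \<in> ?Fix then 0 else 1 :: nat)" for x
  have "p dvd (\<Sum>x\<in>o'. f x)" if o': "o' \<in> orbits G E \<phi>" for o'
  proof -
    obtain x where x: "x \<in> E" "o' = orbit G \<phi> x" using o' unfolding orbits_def by blast
    have sub: "o' \<subseteq> E" using o' orbits_coverture by blast
    show ?thesis
    proof (cases "\<exists>y \<in> o'. y \<in> ?Fix")
      case True
      then obtain y where y: "y \<in> o'" "y \<in> ?Fix" by blast
      then have "x \<in> orbit G \<phi> y" using orbit_sym x by auto
      then have "x = y" using y by (auto simp: orbit_def)
      then have "o' = {x}" using x y by (auto simp: orbit_def)
      then show ?thesis using y \<open>x = y\<close> by (simp add: f_def)
    next
      case False
      then have "(\<Sum>x\<in>o'. f x) = (\<Sum>x\<in>o'. 1)"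
        by (intro sum.cong) (auto simp: f_def)
      then have "(\<Sum>x\<in>o'. f x) = card o'" by simp
      moreover have "card o' \<noteq> 1"
      proof
        assume "card o' = 1"
        then have "o' = {x}" using orbit_refl x by (metis card_1_singletonE singletonD)
        then have "\<phi> g x = x" if "g \<in> carrier G" for g using that x by (auto simp: orbit_def)
        then show False using False x \<open>o' = {x}\<close> by auto
      qed
      ultimately show ?thesis using orb x by simp
    qed
  qed
  then have "p dvd (\<Sum>o'\<in>orbits G E \<phi>. \<Sum>x\<in>o'. f x)" by (rule dvd_sum)
  then have "p dvd (\<Sum>x\<in>E. f x)" using disjoint_sum[OF finE] by metis
  moreover have "(\<Sum>x\<in>E. f x) = card (E - ?Fix)"
  proof -
    have "(\<Sum>x\<in>E. f x) = (\<Sum>x\<in>E - ?Fix. 1)"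
      by (rule sum.mono_neutral_cong_right) (use finE in \<open>auto simp: f_def\<close>)
    then show ?thesis by simp
  qed
  moreover have "card E = card (?Fix \<union> (E - ?Fix))" by (rule arg_cong[of _ _ card]) blast
  then have "card E = card ?Fix + card (E - ?Fix)"
    using finE by (subst (asm) card_Un_disjoint) auto
  ultimately show ?thesis using dvd by (simp add: dvd_add_left_iff)
qed

section \<open>The central series of a group with operators\<close>

text \<open>The last assumption makes every invariant subgroup normal, and this is what closes the terms of the
series below under products.\<close>
locale automorphism_action = group G for G (structure) +
  fixes \<Gamma> :: "('c, 'd) monoid_scheme" and act :: "'c \<Rightarrow> 'a \<Rightarrow> 'a"
  assumes acting_group: "group \<Gamma>"
    and act_closed: "\<gamma> \<in> carrier \<Gamma> \<Longrightarrow> x \<in> carrier G \<Longrightarrow> act \<gamma> x \<in> carrier G"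
    and act_mult: "\<gamma> \<in> carrier \<Gamma> \<Longrightarrow> x \<in> carrier G \<Longrightarrow> y \<in> carrier G \<Longrightarrow>
      act \<gamma> (x \<otimes> y) = act \<gamma> x \<otimes> act \<gamma> y"
    and act_one: "x \<in> carrier G \<Longrightarrow> act \<one>\<^bsub>\<Gamma>\<^esub> x = x"
    and act_comp: "\<gamma> \<in> carrier \<Gamma> \<Longrightarrow> \<delta> \<in> carrier \<Gamma> \<Longrightarrow> x \<in> carrier G \<Longrightarrow>
      act (\<gamma> \<otimes>\<^bsub>\<Gamma>\<^esub> \<delta>) x = act \<gamma> (act \<delta> x)"
    and act_inner: "g \<in> carrier G \<Longrightarrow> \<exists>\<gamma>\<in>carrier \<Gamma>. \<forall>x\<in>carrier G. act \<gamma> x = g \<otimes> x \<otimes> inv g"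
begin

interpretation \<Gamma>: group \<Gamma> by (rule acting_group)

lemma act_hom: "\<gamma> \<in> carrier \<Gamma> \<Longrightarrow> group_hom G G (act \<gamma>)"
  using group_axioms act_closed act_mult
  by (auto simp: group_hom_def group_hom_axioms_def hom_def)

lemma act_inv: "\<gamma> \<in> carrier \<Gamma> \<Longrightarrow> x \<in> carrier G \<Longrightarrow> act \<gamma> (inv x) = inv (act \<gamma> x)"
  using group_hom.hom_inv[OF act_hom] by blast

lemma act_unit: "\<gamma> \<in> carrier \<Gamma> \<Longrightarrow> act \<gamma> \<one> = \<one>"
  using group_hom.hom_one[OF act_hom] by blast

lemma act_p_elements:
  assumes "\<gamma> \<in> carrier \<Gamma>" "x \<in> p_elements p G"
  shows "act \<gamma> x \<in> p_elements p G"
proof -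
  obtain k where k: "x \<in> carrier G" "x [^] (p ^ k) = \<one>"
    using assms(2) by (auto simp: p_elements_def)
  have "act \<gamma> x [^] (p ^ k) = act \<gamma> (x [^] (p ^ k))"
    using group_hom.hom_nat_pow[OF act_hom] assms(1) k(1) by metis
  then show ?thesis using k assms(1) act_unit act_closed by (auto simp: p_elements_def)
qed

text \<open>The autocentral series when the automorphism group acts, and the upper central series when \<open>G\<close> acts
on itself by conjugation.\<close>
primrec central_term :: "nat \<Rightarrow> 'a set" where
  "central_term 0 = {\<one>}"
| "central_term (Suc n) = {x \<in> carrier G. \<forall>\<gamma>\<in>carrier \<Gamma>. inv x \<otimes> act \<gamma> x \<in> central_term n}"

lemma central_term_carrier: "central_term n \<subseteq> carrier G"
  by (cases n) auto

lemma central_term_mono_Suc: "central_term n \<subseteq> central_term (Suc n)"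
  by (induction n) (auto simp: act_unit)

lemma normal_of_invariant:
  assumes "subgroup H G" and "\<And>\<gamma> x. \<gamma> \<in> carrier \<Gamma> \<Longrightarrow> x \<in> H \<Longrightarrow> act \<gamma> x \<in> H"
  shows "H \<lhd> G"
  unfolding normal_inv_iff
proof (intro conjI ballI)
  fix g h assume "g \<in> carrier G" "h \<in> H"
  then show "g \<otimes> h \<otimes> inv g \<in> H"
    using act_inner[of g] assms subgroup.subset[OF assms(1)] by (metis subsetD)
qed fact

text \<open>Subgroup and invariance are proved together, since closure of the next term under products relies
on the normality of the present one: \<open>[x y, \<gamma>] = [x, \<gamma>]\<^sup>y [y, \<gamma>]\<close>.\<close>
lemma central_term_invariant_subgroup:
  "subgroup (central_term n) G \<and> (\<forall>\<gamma>\<in>carrier \<Gamma>. \<forall>x\<in>central_term n. act \<gamma> x \<in> central_term n)"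
proof (induction n)
  case 0
  then show ?case using triv_subgroup by (simp add: act_unit)
next
  case (Suc n)
  then interpret N: normal "central_term n" G by (intro normal_of_invariant) auto
  have "subgroup (central_term (Suc n)) G"
  proof (rule subgroupI)
    show "central_term (Suc n) \<noteq> {}" using act_unit N.one_closed by auto
  next
    fix x assume x: "x \<in> central_term (Suc n)"
    have "inv (inv x) \<otimes> act \<gamma> (inv x) \<in> central_term n" if \<gamma>: "\<gamma> \<in> carrier \<Gamma>" for \<gamma>
    proof -
      have "x \<otimes> inv (inv x \<otimes> act \<gamma> x) \<otimes> inv x \<in> central_term n"
        using x \<gamma> by (intro N.inv_op_closed2) auto
      moreover have "x \<otimes> inv (inv x \<otimes> act \<gamma> x) \<otimes> inv x = inv (inv x) \<otimes> act \<gamma> (inv x)"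
        using x \<gamma> act_closed by (simp add: act_inv inv_mult_group m_assoc)
      ultimately show ?thesis by simp
    qed
    then show "inv x \<in> central_term (Suc n)" using x by simp
  next
    fix x y assume x: "x \<in> central_term (Suc n)" and y: "y \<in> central_term (Suc n)"
    have "inv (x \<otimes> y) \<otimes> act \<gamma> (x \<otimes> y) \<in> central_term n" if \<gamma>: "\<gamma> \<in> carrier \<Gamma>" for \<gamma>
    proof -
      have G: "x \<in> carrier G" "y \<in> carrier G" "act \<gamma> x \<in> carrier G" "act \<gamma> y \<in> carrier G"
        using x y \<gamma> act_closed by auto
      have "(inv y \<otimes> (inv x \<otimes> act \<gamma> x) \<otimes> y) \<otimes> (inv y \<otimes> act \<gamma> y) \<in> central_term n"
        using x y \<gamma> by (intro N.m_closed[OF N.inv_op_closed1]) auto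
      moreover have "y \<otimes> (inv y \<otimes> act \<gamma> y) = act \<gamma> y"
        using G by (simp flip: m_assoc)
      then have "(inv y \<otimes> (inv x \<otimes> act \<gamma> x) \<otimes> y) \<otimes> (inv y \<otimes> act \<gamma> y)
          = inv (x \<otimes> y) \<otimes> act \<gamma> (x \<otimes> y)"
        using G \<gamma> by (simp add: act_mult inv_mult_group m_assoc)
      ultimately show ?thesis by simp
    qed
    then show "x \<otimes> y \<in> central_term (Suc n)" using x y by simp
  qed auto
  moreover have "act \<delta> x \<in> central_term (Suc n)"
    if \<delta>: "\<delta> \<in> carrier \<Gamma>" and x: "x \<in> central_term (Suc n)" for \<delta> x
  proof -
    have "inv (act \<delta> x) \<otimes> act \<gamma> (act \<delta> x) \<in> central_term n" if \<gamma>: "\<gamma> \<in> carrier \<Gamma>" for \<gamma>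
    proof -
      \<comment> \<open>\<open>[x\<^sup>\<delta>, \<gamma>]\<close> is the image under \<open>\<delta>\<close> of the commutator of \<open>x\<close> with the conjugate of \<open>\<gamma>\<close> by \<open>\<delta>\<close>.\<close>
      let ?\<gamma>' = "inv\<^bsub>\<Gamma>\<^esub> \<delta> \<otimes>\<^bsub>\<Gamma>\<^esub> (\<gamma> \<otimes>\<^bsub>\<Gamma>\<^esub> \<delta>)"
      have "\<delta> \<otimes>\<^bsub>\<Gamma>\<^esub> ?\<gamma>' = \<gamma> \<otimes>\<^bsub>\<Gamma>\<^esub> \<delta>"
        using \<gamma> \<delta> by (simp flip: \<Gamma>.m_assoc)
      then have "act \<delta> (act ?\<gamma>' x) = act \<gamma> (act \<delta> x)"
        using \<gamma> \<delta> x by (simp flip: act_comp)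
      then have "inv (act \<delta> x) \<otimes> act \<gamma> (act \<delta> x) = act \<delta> (inv x \<otimes> act ?\<gamma>' x)"
        using \<gamma> \<delta> x act_closed by (simp add: act_mult act_inv)
      moreover have "inv x \<otimes> act ?\<gamma>' x \<in> central_term n" using \<gamma> \<delta> x by simp
      ultimately show ?thesis using Suc \<delta> by simp
    qed
    then show ?thesis using x \<delta> act_closed by simp
  qed
  ultimately show ?case by blast
qed

lemma central_term_normal: "central_term n \<lhd> G"
  using central_term_invariant_subgroup normal_of_invariant by blast

text \<open>The acting group permutes the cosets of \<open>central_term n \<inter> P\<close> in the subgroup \<open>P\<close> of
\<open>p\<close>-elements. Their number is divisible by \<open>p\<close>, hence so is the number of fixed ones, and a fixed
coset \<open>E #> a \<noteq> E\<close> yields an element \<open>a\<close> of the next term.\<close>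
lemma central_term_psubset_Suc:
  assumes finG: "finite (carrier G)" and fin\<Gamma>: "finite (carrier \<Gamma>)"
    and Sylow: "\<And>p. prime p \<Longrightarrow> subgroup (p_elements p G) G"
    and triv: "\<And>p q \<gamma> x. prime p \<Longrightarrow> prime q \<Longrightarrow> q \<noteq> p \<Longrightarrow> \<gamma> \<in> p_elements q \<Gamma> \<Longrightarrow>
      x \<in> p_elements p G \<Longrightarrow> act \<gamma> x = x"
    and ne: "central_term n \<noteq> carrier G"
  shows "central_term n \<subset> central_term (Suc n)"
proof -
  interpret N: normal "central_term n" G by (rule central_term_normal)
  obtain p where p: "prime p" "\<not> p_elements p G \<subseteq> central_term n"
    using eq_carrier_of_p_elements[OF finG N.subgroup_axioms] ne by blast
  let ?P = "p_elements p G"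
  let ?H = "G\<lparr>carrier := ?P\<rparr>"
  let ?E = "central_term n \<inter> ?P"
  let ?X = "rcosets\<^bsub>?H\<^esub> ?E"
  have P: "subgroup ?P G" using Sylow p by blast
  then have PG: "?P \<subseteq> carrier G" by (rule subgroup.subset)
  interpret H: group ?H using P by (rule subgroup_imp_group)
  have E: "subgroup ?E G" using subgroups_Inter_pair N.subgroup_axioms P by blast
  then have EH: "subgroup ?E ?H" using P by (simp add: subgroup_incl)
  have X: "?X = (\<lambda>a. ?E #> a) ` ?P" by (auto simp: RCOSETS_def)
  have finX: "finite ?X" using X finG PG finite_subset by (metis finite_imageI)
  have inv_E: "act \<gamma> ` ?E = ?E" if \<gamma>: "\<gamma> \<in> carrier \<Gamma>" for \<gamma>
  proof -
    have "act \<delta> ` ?E \<subseteq> ?E" if "\<delta> \<in> carrier \<Gamma>" for \<delta>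
      using that central_term_invariant_subgroup act_p_elements by blast
    moreover have "x \<in> act \<gamma> ` ?E" if x: "x \<in> ?E" for x
    proof
      show "x = act \<gamma> (act (inv\<^bsub>\<Gamma>\<^esub> \<gamma>) x)"
        using \<gamma> x PG act_one by (auto simp flip: act_comp)
      show "act (inv\<^bsub>\<Gamma>\<^esub> \<gamma>) x \<in> ?E"
        using calculation[of "inv\<^bsub>\<Gamma>\<^esub> \<gamma>"] \<gamma> x by blast
    qed
    ultimately show ?thesis using \<gamma> by blast
  qed
  have act_coset: "act \<gamma> ` (?E #> a) = ?E #> act \<gamma> a" if "\<gamma> \<in> carrier \<Gamma>" "a \<in> ?P" for \<gamma> a
  proof -
    have "act \<gamma> ` (?E #> a) = (\<lambda>e. act \<gamma> (e \<otimes> a)) ` ?E"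
      by (auto simp: r_coset_def)
    also have "\<dots> = (\<lambda>e. act \<gamma> e \<otimes> act \<gamma> a) ` ?E"
      using that PG by (intro image_cong) (auto simp: act_mult)
    also have "\<dots> = (\<lambda>e. e \<otimes> act \<gamma> a) ` (act \<gamma> ` ?E)" by (simp add: image_image)
    also have "\<dots> = ?E #> act \<gamma> a" using inv_E that(1) by (auto simp: r_coset_def)
    finally show ?thesis .
  qed
  let ?\<phi> = "\<lambda>\<gamma>. \<lambda>C\<in>?X. act \<gamma> ` C"
  have "group_action \<Gamma> ?X ?\<phi>"
  proof (rule group_actionI[OF acting_group])
    show "act \<gamma> ` C \<in> ?X" if "\<gamma> \<in> carrier \<Gamma>" "C \<in> ?X" for \<gamma> C
      using that act_coset act_p_elements unfolding X by blast
    show "act \<one>\<^bsub>\<Gamma>\<^esub> ` C = C" if "C \<in> ?X" for C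
    proof -
      obtain a where "a \<in> ?P" "C = ?E #> a" using \<open>C \<in> ?X\<close> X by blast
      then show ?thesis using act_coset[of "\<one>\<^bsub>\<Gamma>\<^esub>" a] PG act_one by auto
    qed
    show "act (\<gamma> \<otimes>\<^bsub>\<Gamma>\<^esub> \<delta>) ` C = act \<gamma> ` act \<delta> ` C"
      if "\<gamma> \<in> carrier \<Gamma>" "\<delta> \<in> carrier \<Gamma>" "C \<in> ?X" for \<gamma> \<delta> C
    proof -
      obtain a where "a \<in> ?P" "C = ?E #> a" using \<open>C \<in> ?X\<close> X by blast
      then show ?thesis
        using act_coset that(1,2) act_p_elements act_comp PG by auto
    qed
  qed
  then interpret X: group_action \<Gamma> ?X ?\<phi> .
  define Fix where "Fix = {C \<in> ?X. \<forall>\<gamma>\<in>carrier \<Gamma>. ?\<phi> \<gamma> C = C}"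
  have "p dvd card Fix"
    unfolding Fix_def
  proof (rule X.prime_dvd_card_fixed_points[OF fin\<Gamma> finX p(1)])
    fix q \<gamma> C assume q: "prime q" "q \<noteq> p" "\<gamma> \<in> p_elements q \<Gamma>" and C: "C \<in> ?X"
    obtain a where a: "a \<in> ?P" "C = ?E #> a" using C X by blast
    have "\<gamma> \<in> carrier \<Gamma>" using q by (simp add: p_elements_def)
    then show "?\<phi> \<gamma> C = C" using a C act_coset triv[OF p(1) q] by simp
  next
    have "?P \<subseteq> p_elements p ?H" by (simp add: p_elements_subgroup[OF P])
    moreover have "finite ?P" using finG PG finite_subset by blast
    ultimately obtain k where k: "card ?P = p ^ k"
      using H.order_prime_power_of_p_elements[OF _ p(1)] by (auto simp: order_def)
    have lag: "card ?X * card ?E = card ?P" using H.lagrange[OF EH] by (simp add: order_def)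
    have "card ?X \<noteq> 1"
    proof
      assume "card ?X = 1"
      then have "?E = ?P" using lag finG PG by (intro card_subset_eq) (auto intro: finite_subset)
      then show False using p by blast
    qed
    moreover have "card ?X dvd p ^ k" using lag k by (metis dvd_triv_left)
    ultimately show "p dvd card ?X"
      using p(1) by (metis divides_primepow_nat dvd_power power_0 neq0_conv)
  qed
  moreover have E_Fix: "?E \<in> Fix"
  proof -
    have "?E #> \<one> = ?E" using PG by (intro coset_mult_one) blast
    then have "?E \<in> ?X" using X subgroup.one_closed[OF P] by blast
    then show ?thesis using inv_E by (simp add: Fix_def)
  qed
  moreover have "finite Fix" using finX by (simp add: Fix_def)
  ultimately have "p \<le> card Fix" by (metis card_0_eq dvd_imp_le empty_iff gr0I)
  then have "2 \<le> card Fix" using prime_ge_2_nat[OF p(1)] by simp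
  then have "\<not> Fix \<subseteq> {?E}" using card_mono[of "{?E}" Fix] by auto
  then obtain C where "C \<in> Fix" and C_ne: "C \<noteq> ?E" by blast
  then have C: "C \<in> ?X" by (simp add: Fix_def)
  have C_fix: "act \<gamma> ` C = C" if "\<gamma> \<in> carrier \<Gamma>" for \<gamma>
    using \<open>C \<in> Fix\<close> that C by (simp add: Fix_def)
  from C obtain a where a: "a \<in> ?P" "C = ?E #> a" using X by blast
  have aG: "a \<in> carrier G" using a PG by blast
  have "a \<notin> central_term n" using a C_ne coset_join2[OF aG E] by blast
  moreover have "inv a \<otimes> act \<gamma> a \<in> central_term n" if \<gamma>: "\<gamma> \<in> carrier \<Gamma>" for \<gamma>
  proof -
    have "act \<gamma> a \<in> ?E #> a"
      using rcos_self[OF aG E] C_fix[OF \<gamma>] a(2) by blast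
    then obtain e where e: "e \<in> ?E" "act \<gamma> a = e \<otimes> a" by (auto simp: r_coset_def)
    then show ?thesis
      using N.inv_op_closed1[OF aG, of e] aG PG by (auto simp: m_assoc)
  qed
  ultimately show ?thesis using central_term_mono_Suc aG by auto
qed

theorem central_term_eq_carrier:
  assumes finG: "finite (carrier G)" and fin\<Gamma>: "finite (carrier \<Gamma>)"
    and Sylow: "\<And>p. prime p \<Longrightarrow> subgroup (p_elements p G) G"
    and triv: "\<And>p q \<gamma> x. prime p \<Longrightarrow> prime q \<Longrightarrow> q \<noteq> p \<Longrightarrow> \<gamma> \<in> p_elements q \<Gamma> \<Longrightarrow>
      x \<in> p_elements p G \<Longrightarrow> act \<gamma> x = x"
  shows "\<exists>n. central_term n = carrier G"
proof (rule ccontr)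
  assume none: "\<nexists>n. central_term n = carrier G"
  have "n \<le> card (central_term n)" for n
  proof (induction n)
    case (Suc n)
    have "central_term n \<subset> central_term (Suc n)"
      by (rule central_term_psubset_Suc[OF finG fin\<Gamma>])
         (rule Sylow, assumption, rule triv, assumption+, use none in blast)
    then have "card (central_term n) < card (central_term (Suc n))"
      using finG central_term_carrier by (intro psubset_card_mono) (auto intro: finite_subset)
    then show ?case using Suc by simp
  qed simp
  moreover have "card (central_term n) \<le> order G" for n
    unfolding order_def using finG central_term_carrier by (intro card_mono) auto
  ultimately have "Suc (order G) \<le> order G" using le_trans by blast
  then show False by simp
qed

end

section \<open>Nilpotency as commutation of elements of coprime order\<close>

text \<open>For finite groups this is nilpotency, put in terms of elements alone.\<close>
definition coprime_commuting :: "('a, 'b) monoid_scheme \<Rightarrow> bool" where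
  "coprime_commuting G \<longleftrightarrow>
    (\<forall>p q. prime p \<longrightarrow> prime q \<longrightarrow> p \<noteq> q \<longrightarrow>
      (\<forall>x \<in> p_elements p G. \<forall>y \<in> p_elements q G. x \<otimes>\<^bsub>G\<^esub> y = y \<otimes>\<^bsub>G\<^esub> x))"

text \<open>Only the inclusion of the conjugate in \<open>H\<close> is demanded; for a subset \<open>H\<close> of a finite group this is
the normalizer.\<close>
definition normalizing :: "('a, 'b) monoid_scheme \<Rightarrow> 'a set \<Rightarrow> 'a set" where
  "normalizing G H = {g \<in> carrier G. \<forall>h\<in>H. g \<otimes>\<^bsub>G\<^esub> h \<otimes>\<^bsub>G\<^esub> inv\<^bsub>G\<^esub> g \<in> H}"

lemma (in group) conj_conj:
  assumes "g \<in> carrier G" "h \<in> carrier G" "x \<in> carrier G"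
  shows "g \<otimes> (h \<otimes> x \<otimes> inv h) \<otimes> inv g = (g \<otimes> h) \<otimes> x \<otimes> inv (g \<otimes> h)"
  using assms by (simp add: m_assoc inv_mult_group)

lemma (in group) conj_mult:
  assumes "g \<in> carrier G" "x \<in> carrier G" "y \<in> carrier G"
  shows "g \<otimes> (x \<otimes> y) \<otimes> inv g = (g \<otimes> x \<otimes> inv g) \<otimes> (g \<otimes> y \<otimes> inv g)"
proof -
  have "inv g \<otimes> (g \<otimes> (y \<otimes> inv g)) = y \<otimes> inv g"
    using assms by (simp flip: m_assoc)
  then show ?thesis using assms by (simp add: m_assoc)
qed

lemma (in group) finite_subgroupI:
  assumes "finite (carrier G)" "H \<subseteq> carrier G" "\<one> \<in> H"
    and mult: "\<And>x y. x \<in> H \<Longrightarrow> y \<in> H \<Longrightarrow> x \<otimes> y \<in> H"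
  shows "subgroup H G"
proof (rule subgroupI)
  fix x assume x: "x \<in> H"
  have "x [^] n \<in> H" for n :: nat
    by (induction n) (use assms x in auto)
  moreover have "x [^] (order G - 1) \<otimes> x = \<one>"
    using pow_order_eq_1[of x] x assms(1,2) order_gt_0_iff_finite
    by (metis One_nat_def Suc_pred nat_pow_Suc subsetD)
  then have "inv x = x [^] (order G - 1)"
    using x assms(2) by (intro inv_equality) auto
  ultimately show "inv x \<in> H" by simp
qed (use assms in auto)

lemma (in group) subgroup_normalizing:
  assumes fin: "finite (carrier G)" and H: "H \<subseteq> carrier G"
  shows "subgroup (normalizing G H) G"
proof (rule finite_subgroupI[OF fin])
  fix x y assume xy: "x \<in> normalizing G H" "y \<in> normalizing G H"
  then have "(x \<otimes> y) \<otimes> h \<otimes> inv (x \<otimes> y) \<in> H" if "h \<in> H" for h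
    using that H by (auto simp: normalizing_def simp flip: conj_conj)
  then show "x \<otimes> y \<in> normalizing G H" using xy by (simp add: normalizing_def)
qed (use H in \<open>auto simp: normalizing_def\<close>)

lemma (in group) subgroup_le_normalizing:
  "subgroup H G \<Longrightarrow> H \<subseteq> normalizing G H"
  by (auto simp: normalizing_def subgroup.m_closed subgroup.m_inv_closed subgroup.mem_carrier)

lemma (in group) normal_iff_normalizing:
  "H \<lhd> G \<longleftrightarrow> subgroup H G \<and> normalizing G H = carrier G"
  unfolding normal_inv_iff normalizing_def by blast

lemma (in group) subgroup_eq_carrier_of_Sylow:
  assumes fin: "finite (carrier G)" and H: "subgroup H G"
    and Sylow: "\<And>q. prime q \<Longrightarrow> \<exists>Q. subgroup Q G \<and> card Q = q ^ multiplicity q (order G) \<and> Q \<subseteq> H"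
  shows "H = carrier G"
proof -
  have pos: "card H > 0" "order G > 0"
    using fin subgroup.finite_imp_card_positive[OF H] by (simp_all add: order_gt_0_iff_finite)
  have "order G dvd card H"
  proof (rule multiplicity_le_imp_dvd)
    fix q :: nat assume q: "prime q"
    obtain Q where Q: "subgroup Q G" "card Q = q ^ multiplicity q (order G)" "Q \<subseteq> H"
      using Sylow q by blast
    then have "q ^ multiplicity q (order G) dvd card H"
      using subgroup_card_dvd[OF Q(1) H] by simp
    then show "multiplicity q (order G) \<le> multiplicity q (card H)"
      using q pos by (intro multiplicity_geI) auto
  qed (use pos in auto)
  then have "card (carrier G) \<le> card H" using pos dvd_imp_le by (auto simp: order_def)
  then show ?thesis using fin subgroup.subset[OF H] card_seteq by blast
qed

text \<open>A Sylow \<open>p\<close>-subgroup \<open>P\<close> is centralized by a Sylow \<open>q\<close>-subgroup for every \<open>q \<noteq> p\<close>, so its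
normalizer has full order. Being normal of index prime to \<open>p\<close>, \<open>P\<close> contains all \<open>p\<close>-elements.\<close>
lemma (in group) subgroup_p_elements:
  assumes fin: "finite (carrier G)" and cc: "coprime_commuting G" and p: "prime p"
  shows "subgroup (p_elements p G) G"
proof -
  obtain P where P: "subgroup P G" "card P = p ^ multiplicity p (order G)"
    using exists_Sylow_subgroup[OF fin p] by blast
  have P_el: "P \<subseteq> p_elements p G" by (rule subgroup_card_prime_power_p_elements[OF P p])
  have PG: "P \<subseteq> carrier G" by (rule subgroup.subset[OF P(1)])
  have "normalizing G P = carrier G"
  proof (rule subgroup_eq_carrier_of_Sylow[OF fin subgroup_normalizing[OF fin PG]])
    fix q :: nat assume q: "prime q"
    show "\<exists>Q. subgroup Q G \<and> card Q = q ^ multiplicity q (order G) \<and> Q \<subseteq> normalizing G P"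
    proof (cases "q = p")
      case True
      then show ?thesis using P subgroup_le_normalizing by blast
    next
      case False
      obtain Q where Q: "subgroup Q G" "card Q = q ^ multiplicity q (order G)"
        using exists_Sylow_subgroup[OF fin q] by blast
      have QG: "Q \<subseteq> carrier G" by (rule subgroup.subset[OF Q(1)])
      have "x \<otimes> h \<otimes> inv x = h" if "x \<in> Q" "h \<in> P" for x h
      proof -
        have "h \<otimes> x = x \<otimes> h"
          using that cc p q False P_el subgroup_card_prime_power_p_elements[OF Q q]
          unfolding coprime_commuting_def by blast
        then show ?thesis using that PG QG by (metis inv_solve_right m_closed subsetD)
      qed
      then have "Q \<subseteq> normalizing G P" using QG by (auto simp: normalizing_def)
      then show ?thesis using Q by blast
    qed
  qed
  then have "P \<lhd> G" using P(1) by (simp add: normal_iff_normalizing)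
  then interpret P: normal P G .
  have ind: "card (rcosets P) * p ^ multiplicity p (order G) = order G"
    using lagrange[OF P(1)] P(2) by simp
  have "order G > 0" using fin by (simp add: order_gt_0_iff_finite)
  have "\<not> p dvd card (rcosets P)"
  proof
    assume "p dvd card (rcosets P)"
    then have "p ^ Suc (multiplicity p (order G)) dvd order G"
      using ind by (metis dvd_refl mult_dvd_mono power_Suc)
    then have "Suc (multiplicity p (order G)) \<le> multiplicity p (order G)"
      using p \<open>order G > 0\<close> by (intro multiplicity_geI) auto
    then show False by simp
  qed
  then have "coprime p (card (rcosets P))" using p prime_imp_coprime by blast
  then have "p_elements p G \<subseteq> P"
    using p_element_mem_of_coprime_power[OF P(1)] P.pow_index_mem
    by (auto simp: p_elements_def)
  then show ?thesis using P_el P(1) by (metis subset_antisym)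
qed

lemma (in group) conjugation_automorphism_action:
  "automorphism_action G G (\<lambda>g x. g \<otimes> x \<otimes> inv g)"
  by unfold_locales (auto simp: conj_conj intro: conj_mult)

text \<open>In the upper central series, pick the last term contained in \<open>D\<close>. Any element of the next term
outside \<open>D\<close> has its commutators with \<open>D\<close> in \<open>D\<close>.\<close>
lemma (in group) normalizer_condition:
  assumes fin: "finite (carrier G)" and cc: "coprime_commuting G"
    and D: "subgroup D G" "D \<noteq> carrier G"
  shows "\<exists>x \<in> carrier G - D. \<forall>d\<in>D. x \<otimes> d \<otimes> inv x \<in> D"
proof -
  interpret C: automorphism_action G G "\<lambda>g x. g \<otimes> x \<otimes> inv g"
    by (rule conjugation_automorphism_action)
  have "\<exists>n. C.central_term n = carrier G"
  proof (rule C.central_term_eq_carrier[OF fin fin])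
    fix p q \<gamma> x
    assume *: "prime p" "prime q" "q \<noteq> p" "\<gamma> \<in> p_elements q G" "x \<in> p_elements p G"
    then have "\<gamma> \<otimes> x = x \<otimes> \<gamma>" using cc unfolding coprime_commuting_def by blast
    then show "\<gamma> \<otimes> x \<otimes> inv \<gamma> = x"
      using * by (auto simp: p_elements_def m_assoc)
  qed (rule subgroup_p_elements[OF fin cc])
  then obtain N where N: "\<not> C.central_term N \<subseteq> D" using D subgroup.subset by blast
  have "\<exists>n. C.central_term n \<subseteq> D \<and> \<not> C.central_term (Suc n) \<subseteq> D"
  proof (rule ccontr)
    assume none: "\<not> ?thesis"
    have "C.central_term n \<subseteq> D" for n
    proof (induction n)
      case 0
      show ?case using subgroup.one_closed[OF D(1)] by simp
    qed (use none in blast)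
    with N show False by blast
  qed
  then obtain n where n: "C.central_term n \<subseteq> D" "\<not> C.central_term (Suc n) \<subseteq> D" by blast
  then obtain x where x: "x \<in> C.central_term (Suc n)" "x \<notin> D" by blast
  have xG: "x \<in> carrier G" using x(1) C.central_term_carrier by blast
  have "inv x \<otimes> d \<otimes> inv (inv x) \<in> D" if d: "d \<in> D" for d
  proof -
    have dG: "d \<in> carrier G" by (rule subgroup.mem_carrier[OF D(1) d])
    have "inv x \<otimes> (d \<otimes> x \<otimes> inv d) \<in> C.central_term n" using x(1) dG by simp
    then have "inv x \<otimes> (d \<otimes> x \<otimes> inv d) \<otimes> d \<in> D"
      using n(1) d subgroup.m_closed[OF D(1)] by blast
    then show ?thesis using dG xG by (simp add: m_assoc)
  qed
  moreover have "inv x \<notin> D" using x(2) xG subgroup.m_inv_closed[OF D(1), of "inv x"] by auto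
  ultimately show ?thesis using xG by blast
qed

lemma (in group) subgroup_normalizer_condition:
  assumes fin: "finite (carrier G)" and K: "subgroup K G" "coprime_commuting (G\<lparr>carrier := K\<rparr>)"
    and D: "subgroup D G" "D \<subset> K"
  shows "\<exists>x \<in> K - D. x \<in> normalizing G D"
proof -
  interpret K: group "G\<lparr>carrier := K\<rparr>" using K(1) by (rule subgroup_imp_group)
  have KG: "K \<subseteq> carrier G" by (rule subgroup.subset[OF K(1)])
  have "subgroup D (G\<lparr>carrier := K\<rparr>)" using D K by (simp add: subgroup_incl psubset_imp_subset)
  moreover have "finite K" using fin KG finite_subset by blast
  ultimately obtain x where "x \<in> K - D" "\<forall>d\<in>D. x \<otimes> d \<otimes> inv\<^bsub>G\<lparr>carrier := K\<rparr>\<^esub> x \<in> D"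
    using K.normalizer_condition[OF _ K(2), of D] D by auto
  then show ?thesis using KG K(1) by (auto simp: normalizing_def m_inv_consistent)
qed

section \<open>A normal maximal subgroup when the proper subgroups are nilpotent\<close>

definition maximal_subgroup :: "'a set \<Rightarrow> ('a, 'b) monoid_scheme \<Rightarrow> bool" where
  "maximal_subgroup M G \<longleftrightarrow> subgroup M G \<and> M \<noteq> carrier G \<and>
    (\<forall>K. subgroup K G \<longrightarrow> M \<subseteq> K \<longrightarrow> K = M \<or> K = carrier G)"

definition conjugate :: "('a, 'b) monoid_scheme \<Rightarrow> 'a \<Rightarrow> 'a set \<Rightarrow> 'a set" where
  "conjugate G g H = (\<lambda>x. g \<otimes>\<^bsub>G\<^esub> x \<otimes>\<^bsub>G\<^esub> inv\<^bsub>G\<^esub> g) ` H"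

lemma (in group) maximal_subgroup_above:
  assumes fin: "finite (carrier G)" and K: "subgroup K G" "K \<noteq> carrier G"
  shows "\<exists>M. maximal_subgroup M G \<and> K \<subseteq> M"
proof -
  let ?S = "{H. subgroup H G \<and> H \<noteq> carrier G}"
  have "?S \<subseteq> Pow (carrier G)" using subgroup.subset by blast
  then have "finite ?S" using fin finite_subset by blast
  moreover have "K \<in> ?S" using K by simp
  ultimately obtain M where "M \<in> ?S" "K \<subseteq> M" "\<forall>H\<in>?S. M \<subseteq> H \<longrightarrow> M = H"
    using finite_has_maximal2[of ?S K] by blast
  then show ?thesis unfolding maximal_subgroup_def by blast
qed

lemma (in group) conjugate_conjugate:
  assumes "g \<in> carrier G" "h \<in> carrier G" "H \<subseteq> carrier G"
  shows "conjugate G g (conjugate G h H) = conjugate G (g \<otimes> h) H"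
  using assms by (auto simp: conjugate_def image_image conj_conj subset_iff intro!: image_cong)

lemma (in group) conjugate_one:
  "H \<subseteq> carrier G \<Longrightarrow> conjugate G \<one> H = H"
  by (auto simp: conjugate_def subset_iff image_iff)

lemma (in group) card_conjugate:
  assumes "g \<in> carrier G" "H \<subseteq> carrier G"
  shows "card (conjugate G g H) = card H"
  unfolding conjugate_def
  by (rule card_image, rule inj_onI) (use assms conjugation_is_inj in blast)

lemma (in group) subgroup_conjugate:
  assumes g: "g \<in> carrier G" and H: "subgroup H G"
  shows "subgroup (conjugate G g H) G"
proof -
  have "group_hom G G (\<lambda>x. g \<otimes> x \<otimes> inv g)"
    using g conj_mult by unfold_locales (auto simp: hom_def)
  then show ?thesis unfolding conjugate_def using H by (rule group_hom.subgroup_img_is_subgroup)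
qed

lemma (in group) conjugate_subset_carrier:
  "g \<in> carrier G \<Longrightarrow> H \<subseteq> carrier G \<Longrightarrow> conjugate G g H \<subseteq> carrier G"
  by (auto simp: conjugate_def)

lemma (in group) conjugate_mono: "H \<subseteq> K \<Longrightarrow> conjugate G g H \<subseteq> conjugate G g K"
  by (auto simp: conjugate_def)

lemma (in group) conjugate_carrier:
  assumes "g \<in> carrier G"
  shows "conjugate G g (carrier G) = carrier G"
proof -
  have "conjugate G g (conjugate G (inv g) (carrier G)) = carrier G"
    using assms by (simp add: conjugate_conjugate conjugate_one)
  then show ?thesis
    using assms conjugate_subset_carrier[of g "carrier G"]
      conjugate_mono[of "conjugate G (inv g) (carrier G)" "carrier G" g]
      conjugate_subset_carrier[of "inv g" "carrier G"] by auto
qed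

lemma (in group) conjugate_eq_swap:
  assumes "g \<in> carrier G" "h \<in> carrier G" "H \<subseteq> carrier G" "K \<subseteq> carrier G"
    and "conjugate G g H = conjugate G h K"
  shows "K = conjugate G (inv h \<otimes> g) H"
proof -
  have "conjugate G (inv h) (conjugate G h K) = K"
    using assms by (simp add: conjugate_conjugate conjugate_one)
  then show ?thesis using assms by (metis conjugate_conjugate inv_closed)
qed

lemma (in group) maximal_subgroup_conjugate:
  assumes g: "g \<in> carrier G" and M: "maximal_subgroup M G"
  shows "maximal_subgroup (conjugate G g M) G"
  unfolding maximal_subgroup_def
proof (intro conjI allI impI)
  have sM: "subgroup M G" using M by (simp add: maximal_subgroup_def)
  have MG: "M \<subseteq> carrier G" by (rule subgroup.subset[OF sM])
  have cancel: "conjugate G (inv g) (conjugate G g H) = H" "conjugate G g (conjugate G (inv g) H) = H"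
    if "H \<subseteq> carrier G" for H
    using that g by (simp_all add: conjugate_conjugate conjugate_one)
  show "subgroup (conjugate G g M) G" using g sM by (rule subgroup_conjugate)
  show "conjugate G g M \<noteq> carrier G"
    using cancel[OF MG] M conjugate_carrier[of "inv g"] g by (auto simp: maximal_subgroup_def)
  fix K assume K: "subgroup K G" "conjugate G g M \<subseteq> K"
  have KG: "K \<subseteq> carrier G" by (rule subgroup.subset[OF K(1)])
  have "M \<subseteq> conjugate G (inv g) K" using conjugate_mono[OF K(2), of "inv g"] cancel[OF MG] by simp
  moreover have "subgroup (conjugate G (inv g) K) G" using g K(1) by (simp add: subgroup_conjugate)
  ultimately have "conjugate G (inv g) K = M \<or> conjugate G (inv g) K = carrier G"
    using M by (simp add: maximal_subgroup_def)
  then show "K = conjugate G g M \<or> K = carrier G"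
    using cancel[OF KG] conjugate_carrier[OF g] by metis
qed

lemma (in group) normalizing_maximal_subgroup:
  assumes fin: "finite (carrier G)" and M: "maximal_subgroup M G" and "\<not> M \<lhd> G"
  shows "normalizing G M = M"
proof -
  have sM: "subgroup M G" using M by (simp add: maximal_subgroup_def)
  have "subgroup (normalizing G M) G"
    by (rule subgroup_normalizing[OF fin subgroup.subset[OF sM]])
  then show ?thesis
    using M sM subgroup_le_normalizing[OF sM] \<open>\<not> M \<lhd> G\<close>
    unfolding maximal_subgroup_def normal_iff_normalizing by blast
qed

text \<open>A maximal subgroup that is not normal is its own normalizer, hence its own stabilizer under
conjugation.\<close>
lemma (in group) card_conjugates_maximal_subgroup:
  assumes fin: "finite (carrier G)" and M: "maximal_subgroup M G" "\<not> M \<lhd> G"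
  shows "card ((\<lambda>g. conjugate G g M) ` carrier G) * card M = order G"
proof -
  let ?C = "(\<lambda>g. conjugate G g M) ` carrier G"
  have sM: "subgroup M G" using M by (simp add: maximal_subgroup_def)
  have MG: "M \<subseteq> carrier G" by (rule subgroup.subset[OF sM])
  have "group_action G ?C (\<lambda>g. \<lambda>H\<in>?C. conjugate G g H)"
    by (rule group_actionI)
       (auto simp: conjugate_conjugate conjugate_one conjugate_subset_carrier MG m_assoc)
  then interpret A: group_action G ?C "\<lambda>g. \<lambda>H\<in>?C. conjugate G g H" .
  have M_in: "M \<in> ?C" using conjugate_one[OF MG] by (metis image_eqI one_closed)
  have "orbit G (\<lambda>g. \<lambda>H\<in>?C. conjugate G g H) M = ?C"
    using M_in by (auto simp: orbit_def)
  moreover have "stabilizer G (\<lambda>g. \<lambda>H\<in>?C. conjugate G g H) M = M"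
  proof -
    have "conjugate G g M = M \<longleftrightarrow> g \<in> normalizing G M" if "g \<in> carrier G" for g
    proof
      show "g \<in> normalizing G M" if "conjugate G g M = M"
        using that \<open>g \<in> carrier G\<close> unfolding conjugate_def normalizing_def by blast
      assume "g \<in> normalizing G M"
      then have "conjugate G g M \<subseteq> M" by (auto simp: conjugate_def normalizing_def)
      moreover have "finite M" using MG fin finite_subset by blast
      ultimately show "conjugate G g M = M"
        using card_conjugate[OF that MG] card_subset_eq by blast
    qed
    then have "stabilizer G (\<lambda>g. \<lambda>H\<in>?C. conjugate G g H) M = carrier G \<inter> normalizing G M"
      using M_in by (auto simp: stabilizer_def)
    then show ?thesis using normalizing_maximal_subgroup[OF fin M] MG by auto
  qed
  ultimately show ?thesis using A.orbit_stabilizer_theorem[OF M_in] by simp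
qed

lemma (in group) normal_subset_conjugate:
  assumes g: "g \<in> carrier G" and D: "D \<lhd> G" "D \<subseteq> H"
  shows "D \<subseteq> conjugate G g H"
proof
  fix d assume d: "d \<in> D"
  have "d \<in> carrier G" using d D(1) normal_imp_subgroup subgroup.subset by blast
  then have "d = g \<otimes> (inv g \<otimes> d \<otimes> g) \<otimes> inv g" using g by (simp add: conjugation_is_surj)
  moreover have "inv g \<otimes> d \<otimes> g \<in> H" using normal.inv_op_closed1[OF D(1) g d] D(2) by blast
  ultimately show "d \<in> conjugate G g H" unfolding conjugate_def by blast
qed

text \<open>The \<open>i = |G : M|\<close> conjugates of \<open>M\<close> contain \<open>D\<close> and meet pairwise in \<open>D\<close>, so they cover
\<open>i (|M| - |D|)\<close> elements outside \<open>D\<close>. This is at least half of \<open>|G| = i |M|\<close> because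
\<open>2 |D| \<le> |M|\<close>, and together with \<open>D\<close> it falls short of \<open>|G|\<close> because \<open>i > 1\<close>.\<close>
lemma (in group) card_union_conjugates:
  assumes fin: "finite (carrier G)" and M: "maximal_subgroup M G" "\<not> M \<lhd> G"
    and D: "D \<lhd> G" "D \<subseteq> M"
    and Int: "\<And>N N'. maximal_subgroup N G \<Longrightarrow> maximal_subgroup N' G \<Longrightarrow>
      D \<subseteq> N \<Longrightarrow> D \<subseteq> N' \<Longrightarrow> N \<noteq> N' \<Longrightarrow> N \<inter> N' = D"
  shows "order G \<le> 2 * card ((\<Union>g\<in>carrier G. conjugate G g M) - D)"
    and "card ((\<Union>g\<in>carrier G. conjugate G g M) - D) + card D < order G"
proof -
  let ?C = "(\<lambda>g. conjugate G g M) ` carrier G"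
  have sM: "subgroup M G" using M by (simp add: maximal_subgroup_def)
  have MG: "M \<subseteq> carrier G" by (rule subgroup.subset[OF sM])
  have finM: "finite M" using MG fin finite_subset by blast
  have sD: "subgroup D G" using D(1) by (rule normal_imp_subgroup)
  have DG: "D \<subseteq> carrier G" by (rule subgroup.subset[OF sD])
  have D_conj: "D \<subseteq> conjugate G g M" if "g \<in> carrier G" for g
    using that D by (rule normal_subset_conjugate)
  have Union: "(\<Union>g\<in>carrier G. conjugate G g M) - D = (\<Union>N\<in>?C. N - D)" by blast
  have "card (\<Union>N\<in>?C. N - D) = (\<Sum>N\<in>?C. card (N - D))"
  proof (rule card_UN_disjoint)
    show "finite ?C" using fin by simp
    show "\<forall>N\<in>?C. finite (N - D)"
      using finite_subset[OF conjugate_subset_carrier[OF _ MG] fin] by blast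
    show "\<forall>N\<in>?C. \<forall>N'\<in>?C. N \<noteq> N' \<longrightarrow> (N - D) \<inter> (N' - D) = {}"
    proof (intro ballI impI)
      fix N N' assume N: "N \<in> ?C" "N' \<in> ?C" "N \<noteq> N'"
      then have "maximal_subgroup N G" "maximal_subgroup N' G" "D \<subseteq> N" "D \<subseteq> N'"
        using maximal_subgroup_conjugate[OF _ M(1)] D_conj by auto
      then have "N \<inter> N' = D" using Int N(3) by blast
      then show "(N - D) \<inter> (N' - D) = {}" by blast
    qed
  qed
  also have "\<dots> = (\<Sum>N\<in>?C. card M - card D)"
  proof (rule sum.cong[OF refl])
    fix N assume "N \<in> ?C"
    then obtain g where g: "g \<in> carrier G" "N = conjugate G g M" by blast
    then show "card (N - D) = card M - card D"
      using card_Diff_subset[OF _ D_conj[OF g(1)]] DG fin card_conjugate[OF g(1) MG]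
      by (auto intro: finite_subset)
  qed
  finally have cardU: "card ((\<Union>g\<in>carrier G. conjugate G g M) - D) = card ?C * (card M - card D)"
    by (simp only: Union sum_constant of_nat_id)
  have CM: "card ?C * card M = order G" by (rule card_conjugates_maximal_subgroup[OF fin M])
  obtain j where j: "card M = card D * j" using subgroup_card_dvd[OF sD sM D(2)] by blast
  have "D \<noteq> M" using D(1) M(2) by blast
  then have "card D < card M" using D(2) finM psubset_card_mono by blast
  then have "j \<noteq> 0" "j \<noteq> 1" using j by auto
  then have "2 \<le> j" by simp
  then have "2 * card D \<le> card M" using j mult_le_mono2[of 2 j "card D"] by simp
  then have "card M \<le> 2 * (card M - card D)" by simp
  then have "card ?C * card M \<le> card ?C * (2 * (card M - card D))" by (rule mult_le_mono2)
  then show "order G \<le> 2 * card ((\<Union>g\<in>carrier G. conjugate G g M) - D)"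
    using cardU CM by simp
  have "card M < order G"
    unfolding order_def using MG M(1) fin
    by (intro psubset_card_mono) (auto simp: maximal_subgroup_def)
  have "1 < card ?C"
  proof (rule ccontr)
    assume "\<not> 1 < card ?C"
    then have "card ?C * card M \<le> 1 * card M" by (intro mult_le_mono1) simp
    with \<open>card M < order G\<close> show False unfolding CM by simp
  qed
  moreover have "0 < card D"
    by (rule subgroup.finite_imp_card_positive[OF sD fin])
  ultimately have "card D < card ?C * card D" by simp
  moreover have "card ?C * card D \<le> card ?C * card M"
    using \<open>card D < card M\<close> by simp
  ultimately show "card ((\<Union>g\<in>carrier G. conjugate G g M) - D) + card D < order G"
    unfolding cardU CM[symmetric] diff_mult_distrib2 by linarith
qed

text \<open>The set is \<open>D\<langle>x\<rangle>\<close>; non-negative exponents suffice in a finite group.\<close>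
lemma (in group) subgroup_normal_times_powers:
  assumes fin: "finite (carrier G)" and D: "D \<lhd> G" and x: "x \<in> carrier G"
  shows "subgroup {z \<in> carrier G. \<exists>n::nat. D #> z = D #> (x [^] n)} G" (is "subgroup ?L G")
proof (rule finite_subgroupI[OF fin])
  interpret D: normal D G by (rule D)
  show "\<one> \<in> ?L" by (auto intro: exI[of _ 0])
  fix y z assume "y \<in> ?L" "z \<in> ?L"
  then obtain m n :: nat where yz: "y \<in> carrier G" "z \<in> carrier G"
    "D #> y = D #> (x [^] m)" "D #> z = D #> (x [^] n)" by blast
  have "D #> (y \<otimes> z) = (D #> y) <#> (D #> z)" using yz(1,2) by (simp only: D.rcos_sum)
  also have "\<dots> = D #> (x [^] (m + n))"
    unfolding yz(3,4) using x by (simp add: D.rcos_sum nat_pow_mult)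
  finally show "y \<otimes> z \<in> ?L" using yz by blast
qed auto

text \<open>Schmidt's argument. Suppose no maximal subgroup is normal, and let \<open>D\<close> be an intersection
\<open>M \<inter> N\<close> of two distinct maximal subgroups of largest possible order. By the choice
of \<open>D\<close>, distinct maximal subgroups containing \<open>D\<close> meet exactly in \<open>D\<close>. If \<open>D\<close> were not normal, a
maximal subgroup containing its normalizer would meet \<open>M\<close> and \<open>N\<close> in more than \<open>D\<close>, by the
normalizer condition in \<open>M\<close> and \<open>N\<close>, and so would equal both. The conjugates of \<open>M\<close> do not cover
\<open>G\<close>; an element \<open>x\<close> outside them lies, together with \<open>D\<close>, in a maximal subgroup \<open>A\<close> that is not
conjugate to \<open>M\<close>. Each of the two conjugacy classes covers at least half of \<open>G\<close>, disjointly and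
outside \<open>D\<close>, which is impossible.\<close>
theorem (in group) exists_normal_maximal_subgroup:
  assumes fin: "finite (carrier G)" and nontriv: "carrier G \<noteq> {\<one>}"
    and nc: "\<And>K D. subgroup K G \<Longrightarrow> K \<noteq> carrier G \<Longrightarrow> subgroup D G \<Longrightarrow> D \<subset> K \<Longrightarrow>
      \<exists>x \<in> K - D. x \<in> normalizing G D"
  shows "\<exists>M. maximal_subgroup M G \<and> M \<lhd> G"
proof (rule ccontr)
  assume "\<nexists>M. maximal_subgroup M G \<and> M \<lhd> G"
  then have not_normal: "\<not> M \<lhd> G" if "maximal_subgroup M G" for M using that by blast
  have sub: "subgroup M G" "M \<subseteq> carrier G" if "maximal_subgroup M G" for M
    using that subgroup.subset unfolding maximal_subgroup_def by blast+
  define S where "S = {M \<inter> N | M N. maximal_subgroup M G \<and> maximal_subgroup N G \<and> M \<noteq> N}"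
  have "S \<noteq> {}"
  proof -
    obtain M where M: "maximal_subgroup M G"
      using maximal_subgroup_above[OF fin triv_subgroup] nontriv by auto
    obtain g where g: "g \<in> carrier G" "g \<notin> normalizing G M"
      using not_normal[OF M] sub(1)[OF M] unfolding normal_iff_normalizing normalizing_def by blast
    then have "conjugate G g M \<noteq> M" unfolding conjugate_def normalizing_def by blast
    then show ?thesis using M maximal_subgroup_conjugate[OF g(1) M] unfolding S_def by blast
  qed
  moreover have "S \<subseteq> Pow (carrier G)" using sub(2) unfolding S_def by blast
  then have "finite S" using fin finite_subset by blast
  ultimately have "Max (card ` S) \<in> card ` S" by (intro Max_in) auto
  then obtain D where D: "D \<in> S" "card D = Max (card ` S)" by auto
  have D_max: "card E \<le> card D" if "E \<in> S" for E
    using that D(2) \<open>finite S\<close> by simp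
  obtain M N where MN: "maximal_subgroup M G" "maximal_subgroup N G" "M \<noteq> N" "D = M \<inter> N"
    using D(1) unfolding S_def by blast
  have sD: "subgroup D G" using MN sub subgroups_Inter_pair by blast
  have DG: "D \<subseteq> carrier G" by (rule subgroup.subset[OF sD])
  have Int_eq_D: "A \<inter> B = D"
    if "maximal_subgroup A G" "maximal_subgroup B G" "D \<subseteq> A" "D \<subseteq> B" "A \<noteq> B" for A B
  proof -
    have "A \<inter> B \<in> S" using that unfolding S_def by blast
    then have "card (A \<inter> B) \<le> card D" by (rule D_max)
    moreover have "finite (A \<inter> B)" using sub(2)[OF that(1)] fin finite_subset by blast
    ultimately show ?thesis using that card_seteq[of "A \<inter> B" D] by blast
  qed
  have "D \<lhd> G"
  proof (rule ccontr)
    assume "\<not> D \<lhd> G"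
    let ?N = "normalizing G D"
    have "subgroup ?N G" by (rule subgroup_normalizing[OF fin DG])
    moreover have "?N \<noteq> carrier G" using \<open>\<not> D \<lhd> G\<close> sD by (simp add: normal_iff_normalizing)
    ultimately obtain L where L: "maximal_subgroup L G" "?N \<subseteq> L"
      using maximal_subgroup_above[OF fin] by blast
    have DL: "D \<subseteq> L" using subgroup_le_normalizing[OF sD] L(2) by blast
    have "A = L" if A: "maximal_subgroup A G" "D \<subset> A" for A
    proof (rule ccontr)
      assume "A \<noteq> L"
      then have "A \<inter> L = D" using Int_eq_D[OF A(1) L(1)] A(2) DL by blast
      moreover obtain x where "x \<in> A - D" "x \<in> ?N"
        using nc[OF sub(1)[OF A(1)] _ sD A(2)] A(1) by (auto simp: maximal_subgroup_def)
      ultimately show False using L(2) by blast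
    qed
    moreover have "\<not> A \<subseteq> B" if "maximal_subgroup A G" "maximal_subgroup B G" "A \<noteq> B" for A B
      using that unfolding maximal_subgroup_def by blast
    then have "D \<subset> M" "D \<subset> N" using MN by blast+
    ultimately show False using MN(1-3) by blast
  qed
  define C where "C A = (\<Union>g\<in>carrier G. conjugate G g A) - D" for A
  have C1: "order G \<le> 2 * card (C A)" "card (C A) + card D < order G"
    if "maximal_subgroup A G" "D \<subseteq> A" for A
    unfolding C_def
    using card_union_conjugates[OF fin that(1) not_normal[OF that(1)] \<open>D \<lhd> G\<close> that(2) Int_eq_D]
    by blast+
  have CG: "C A \<subseteq> carrier G" if "maximal_subgroup A G" for A
    using conjugate_subset_carrier[OF _ sub(2)[OF that]] unfolding C_def by blast
  have DM: "D \<subseteq> M" using MN by blast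
  have "card (C M \<union> D) < card (carrier G)"
    using C1(2)[OF MN(1) DM] card_Un_le[of "C M" D] by (simp add: order_def)
  then obtain x where x: "x \<in> carrier G" "x \<notin> C M" "x \<notin> D"
    using card_mono[of "C M \<union> D" "carrier G"] CG[OF MN(1)] DG fin
    by (metis UnI1 UnI2 Un_least finite_subset leD subsetI)
  interpret D: normal D G by fact
  let ?L = "{z \<in> carrier G. \<exists>n::nat. D #> z = D #> (x [^] n)}"
  have L: "subgroup ?L G" by (rule subgroup_normal_times_powers[OF fin \<open>D \<lhd> G\<close> x(1)])
  \<comment> \<open>If \<open>D\<langle>x\<rangle> = G\<close>, every element of \<open>M\<close> is congruent modulo \<open>D\<close> to a power of \<open>x\<close>, so \<open>x\<close> normalizes \<open>M\<close> and lies in it.\<close>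
  have "?L \<noteq> carrier G"
  proof
    assume L_all: "?L = carrier G"
    have "x \<in> normalizing G M"
      unfolding normalizing_def
    proof (intro CollectI conjI ballI)
      fix m assume m: "m \<in> M"
      have mG: "m \<in> carrier G" using m sub(2)[OF MN(1)] by blast
      then obtain n :: nat where "D #> m = D #> (x [^] n)" using L_all by blast
      then have "x [^] n \<in> D #> m" using rcos_self[OF _ sD, of "x [^] n"] x(1) by simp
      then obtain d where d: "d \<in> D" "x [^] n = d \<otimes> m" by (auto simp: r_coset_def)
      have dG: "d \<in> carrier G" using d DG by blast
      have "x \<otimes> (d \<otimes> m) \<otimes> inv x = d \<otimes> m"
        using x(1) by (metis d(2) inv_solve_right m_closed nat_pow_Suc nat_pow_Suc2 nat_pow_closed)
      then have "(x \<otimes> d \<otimes> inv x) \<otimes> (x \<otimes> m \<otimes> inv x) = d \<otimes> m"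
        using conj_mult[of x d m] x(1) dG mG by simp
      then have "x \<otimes> m \<otimes> inv x = inv (x \<otimes> d \<otimes> inv x) \<otimes> (d \<otimes> m)"
        using x(1) dG mG by (metis inv_closed inv_solve_left m_closed)
      moreover have "inv (x \<otimes> d \<otimes> inv x) \<in> M" "d \<in> M"
        using D.inv_op_closed2[OF x(1) d(1)] d(1) DM by auto
      ultimately show "x \<otimes> m \<otimes> inv x \<in> M"
        using m subgroup.m_closed[OF sub(1)[OF MN(1)]] by simp
    qed (rule x(1))
    then have "x \<in> M" using normalizing_maximal_subgroup[OF fin MN(1) not_normal[OF MN(1)]] by simp
    then have "x \<in> conjugate G \<one> M" using conjugate_one[OF sub(2)[OF MN(1)]] by simp
    then show False using x unfolding C_def by blast
  qed
  then obtain A where A: "maximal_subgroup A G" "?L \<subseteq> A"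
    using maximal_subgroup_above[OF fin L] by blast
  have "x \<in> ?L" using x(1) by (auto intro: exI[of _ 1])
  then have "x \<in> A" using A by blast
  have "D \<subseteq> ?L"
  proof
    fix d assume d: "d \<in> D"
    then have "d \<in> carrier G" using DG by blast
    moreover from this have "D #> d = D #> (x [^] (0::nat))"
      using d DG by (simp add: coset_join2[OF _ sD])
    ultimately show "d \<in> ?L" by blast
  qed
  then have DA: "D \<subseteq> A" using A by blast
  have "C M \<inter> C A = {}"
  proof (rule ccontr)
    assume "C M \<inter> C A \<noteq> {}"
    then obtain z g h where z: "z \<notin> D" "g \<in> carrier G" "h \<in> carrier G"
      "z \<in> conjugate G g M" "z \<in> conjugate G h A"
      unfolding C_def by blast
    have "conjugate G g M = conjugate G h A"
      using Int_eq_D[OF maximal_subgroup_conjugate[OF z(2) MN(1)] maximal_subgroup_conjugate[OF z(3) A(1)]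
          normal_subset_conjugate[OF z(2) \<open>D \<lhd> G\<close> DM]
          normal_subset_conjugate[OF z(3) \<open>D \<lhd> G\<close> DA]] z by blast
    then have "A = conjugate G (inv h \<otimes> g) M"
      using conjugate_eq_swap[OF z(2,3)] sub(2)[OF MN(1)] sub(2)[OF A(1)] by blast
    with \<open>x \<in> A\<close> have "x \<in> conjugate G (inv h \<otimes> g) M" by blast
    moreover have "inv h \<otimes> g \<in> carrier G" using z(2,3) by simp
    ultimately show False using x(2,3) unfolding C_def by blast
  qed
  moreover have fC: "finite (C M)" "finite (C A)"
    using CG[OF MN(1)] CG[OF A(1)] fin finite_subset by blast+
  ultimately have "card (C M \<union> C A) = card (C M) + card (C A)" by (simp add: card_Un_disjoint)
  moreover have "card ((C M \<union> C A) \<union> D) = card (C M \<union> C A) + card D"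
    using fC DG fin by (intro card_Un_disjoint) (auto simp: C_def intro: finite_subset)
  moreover have "card ((C M \<union> C A) \<union> D) \<le> order G"
    unfolding order_def using CG[OF MN(1)] CG[OF A(1)] DG fin by (intro card_mono) auto
  moreover have "0 < card D" by (rule subgroup.finite_imp_card_positive[OF sD fin])
  ultimately show False using C1(1)[OF MN(1) DM] C1(1)[OF A(1) DA] by linarith
qed

section \<open>A local criterion for nilpotency\<close>

text \<open>For finite groups this says that \<open>N(P) / C(P)\<close> is a \<open>p\<close>-group for every \<open>p\<close>-subgroup \<open>P\<close>, with
normalizer and centralizer taken in \<open>G\<close>. The elementwise form passes to subgroups without
quotients having to be compared.\<close>
definition p_local_centralizing :: "('a, 'b) monoid_scheme \<Rightarrow> bool" where
  "p_local_centralizing G \<longleftrightarrow>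
    (\<forall>p q P. prime p \<longrightarrow> prime q \<longrightarrow> p \<noteq> q \<longrightarrow> subgroup P G \<longrightarrow> P \<subseteq> p_elements p G \<longrightarrow>
      (\<forall>g \<in> p_elements q G \<inter> normalizing G P. \<forall>x \<in> P. g \<otimes>\<^bsub>G\<^esub> x = x \<otimes>\<^bsub>G\<^esub> g))"

lemma p_local_centralizingD:
  assumes "p_local_centralizing G" "prime p" "prime q" "p \<noteq> q" "subgroup P G" "P \<subseteq> p_elements p G"
    and "g \<in> p_elements q G" "g \<in> normalizing G P" "x \<in> P"
  shows "g \<otimes>\<^bsub>G\<^esub> x = x \<otimes>\<^bsub>G\<^esub> g"
  using assms unfolding p_local_centralizing_def by blast

lemma (in group) p_local_centralizing_subgroup:
  assumes plc: "p_local_centralizing G" and K: "subgroup K G"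
  shows "p_local_centralizing (G\<lparr>carrier := K\<rparr>)"
  unfolding p_local_centralizing_def
proof (intro allI impI ballI)
  fix p q :: nat and P g x
  assume pq: "prime p" "prime q" "p \<noteq> q"
    and P: "subgroup P (G\<lparr>carrier := K\<rparr>)" "P \<subseteq> p_elements p (G\<lparr>carrier := K\<rparr>)"
    and g: "g \<in> p_elements q (G\<lparr>carrier := K\<rparr>) \<inter> normalizing (G\<lparr>carrier := K\<rparr>) P"
    and x: "x \<in> P"
  have "subgroup P G" by (rule incl_subgroup[OF K P(1)])
  moreover have "P \<subseteq> p_elements p G" "g \<in> p_elements q G"
    using P(2) g by (auto simp: p_elements_subgroup[OF K])
  moreover have "g \<in> normalizing G P"
    using g subgroup.subset[OF K] K by (auto simp: normalizing_def m_inv_consistent)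
  ultimately show "g \<otimes>\<^bsub>G\<lparr>carrier := K\<rparr>\<^esub> x = x \<otimes>\<^bsub>G\<lparr>carrier := K\<rparr>\<^esub> g"
    using p_local_centralizingD[OF plc pq _ _ _ _ x] by simp
qed

lemma (in group) conj_p_element:
  assumes "g \<in> carrier G" "x \<in> p_elements p G"
  shows "g \<otimes> x \<otimes> inv g \<in> p_elements p G"
  using automorphism_action.act_p_elements[OF conjugation_automorphism_action assms] .

text \<open>The \<open>p\<close>-elements of \<open>M\<close> form a subgroup that is normal in \<open>G\<close>, so the local hypothesis makes them
commute with the \<open>q\<close>-elements of \<open>G\<close>. That settles every pair with one member in \<open>M\<close>.\<close>
lemma (in group) coprime_commuting_of_normal_maximal_subgroup:
  assumes fin: "finite (carrier G)" and plc: "p_local_centralizing G"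
    and M: "maximal_subgroup M G" "M \<lhd> G" and cc: "coprime_commuting (G\<lparr>carrier := M\<rparr>)"
  shows "coprime_commuting G"
proof -
  interpret M: normal M G by (rule M(2))
  interpret GM: group "G\<lparr>carrier := M\<rparr>" using M.subgroup_axioms by (rule subgroup_imp_group)
  have MG: "M \<subseteq> carrier G" by (rule M.subset)
  have M_p: "x \<otimes> y = y \<otimes> x"
    if pq: "prime p" "prime q" "p \<noteq> q" and x: "x \<in> p_elements p G" "x \<in> M"
      and y: "y \<in> p_elements q G" for p q x y
  proof -
    let ?P = "p_elements p G \<inter> M"
    have "finite (carrier (G\<lparr>carrier := M\<rparr>))" using finite_subset[OF MG fin] by simp
    then have "subgroup (p_elements p (G\<lparr>carrier := M\<rparr>)) (G\<lparr>carrier := M\<rparr>)"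
      using cc pq(1) by (rule GM.subgroup_p_elements)
    then have P: "subgroup ?P G"
      unfolding p_elements_subgroup[OF M.subgroup_axioms]
      by (rule incl_subgroup[OF M.subgroup_axioms])
    have yG: "y \<in> carrier G" using y by (simp add: p_elements_def)
    have "y \<in> normalizing G ?P"
      using yG conj_p_element[OF yG] M.inv_op_closed2[OF yG] by (auto simp: normalizing_def)
    then have "y \<otimes> x = x \<otimes> y"
      using p_local_centralizingD[OF plc pq P _ y _] x by blast
    then show ?thesis by simp
  qed
  \<comment> \<open>If \<open>y \<notin> M\<close>, then \<open>G = M\<langle>y\<rangle>\<close> by maximality, so \<open>x [^] (q ^ k) \<in> M\<close> for some \<open>k\<close>; since \<open>x\<close> is a \<open>p\<close>-element, \<open>x \<in> M\<close>.\<close>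
  have "x \<in> M \<or> y \<in> M"
    if pq: "prime p" "prime q" "p \<noteq> q" and x: "x \<in> p_elements p G" and y: "y \<in> p_elements q G" for p q x y
  proof (rule disjCI)
    assume "y \<notin> M"
    obtain k where k: "y \<in> carrier G" "y [^] (q ^ k) = \<one>" using y by (auto simp: p_elements_def)
    have xG: "x \<in> carrier G" using x by (simp add: p_elements_def)
    let ?L = "{z \<in> carrier G. \<exists>n::nat. M #> z = M #> (y [^] n)}"
    have L: "subgroup ?L G" by (rule subgroup_normal_times_powers[OF fin M(2) k(1)])
    have "M #> m = M #> (y [^] (0::nat))" if "m \<in> M" for m
      using that MG by (simp add: coset_join2[OF _ M.subgroup_axioms] subset_iff)
    then have "M \<subseteq> ?L" using MG by blast
    moreover have "y \<in> ?L" using k(1) by (auto intro: exI[of _ 1])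
    ultimately have "?L = carrier G"
      using M(1) L \<open>y \<notin> M\<close> unfolding maximal_subgroup_def by blast
    then obtain n :: nat where n: "M #> x = M #> (y [^] n)" using xG by blast
    have "M #> (x [^] (q ^ k)) = (M #> x) [^]\<^bsub>G Mod M\<^esub> (q ^ k)"
      using xG by (simp add: M.FactGroup_pow)
    also have "\<dots> = M #> ((y [^] n) [^] (q ^ k))"
      unfolding n using k(1) by (simp add: M.FactGroup_pow)
    also have "(y [^] n) [^] (q ^ k) = (y [^] (q ^ k)) [^] n"
      using k(1) by (simp add: nat_pow_pow mult.commute)
    finally have "M #> (x [^] (q ^ k)) = M" using k(2) MG by simp
    then have "x [^] (q ^ k) \<in> M"
      using coset_join1[OF _ _ M.subgroup_axioms] nat_pow_closed[OF xG] by blast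
    moreover have "coprime p (q ^ k)" using pq by (simp add: primes_coprime)
    ultimately show "x \<in> M" by (rule p_element_mem_of_coprime_power[OF M.subgroup_axioms x])
  qed
  then show ?thesis
    unfolding coprime_commuting_def using M_p M_p[symmetric] by blast
qed

text \<open>The hypothesis is inherited by subgroups, so by induction all proper subgroups are nilpotent and
satisfy the normalizer condition, which provides a normal maximal subgroup.\<close>
theorem coprime_commuting_of_p_local_centralizing:
  assumes "group G" "finite (carrier G)" "p_local_centralizing G"
  shows "coprime_commuting G"
  using assms
proof (induction "order G" arbitrary: G rule: less_induct)
  case less
  interpret group G by fact
  show ?case
  proof (cases "carrier G = {\<one>\<^bsub>G\<^esub>}")
    case True
    then have "x = \<one>\<^bsub>G\<^esub>" if "x \<in> p_elements p G" for x p
      using that by (simp add: p_elements_def)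
    then show ?thesis unfolding coprime_commuting_def by metis
  next
    case False
    have proper: "coprime_commuting (G\<lparr>carrier := K\<rparr>)" if K: "subgroup K G" "K \<noteq> carrier G" for K
    proof (rule less.hyps)
      have "K \<subset> carrier G" using K subgroup.subset by blast
      then show "order (G\<lparr>carrier := K\<rparr>) < order G"
        using less.prems(2) by (simp add: order_def psubset_card_mono)
      show "group (G\<lparr>carrier := K\<rparr>)" using K(1) by (rule subgroup_imp_group)
      show "finite (carrier (G\<lparr>carrier := K\<rparr>))"
        using finite_subset[OF subgroup.subset[OF K(1)] less.prems(2)] by simp
      show "p_local_centralizing (G\<lparr>carrier := K\<rparr>)"
        by (rule p_local_centralizing_subgroup[OF less.prems(3) K(1)])
    qed
    have "\<exists>M. maximal_subgroup M G \<and> M \<lhd> G"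
      by (rule exists_normal_maximal_subgroup[OF less.prems(2) False])
         (rule subgroup_normalizer_condition[OF less.prems(2) _ proper])
    then obtain M where M: "maximal_subgroup M G" "M \<lhd> G" by blast
    moreover have "coprime_commuting (G\<lparr>carrier := M\<rparr>)"
      using M(1) proper by (simp add: maximal_subgroup_def)
    ultimately show ?thesis
      using coprime_commuting_of_normal_maximal_subgroup less.prems(2,3) by blast
  qed
qed

section \<open>The automorphism group and its action\<close>

lemma carrier_AutoGroup: "carrier (AutoGroup G) = auto G"
  by (simp add: AutoGroup_def)

lemma AutoGroup_mult_apply:
  assumes "\<alpha> \<in> carrier (AutoGroup G)" "\<beta> \<in> carrier (AutoGroup G)" "x \<in> carrier G"
  shows "(\<alpha> \<otimes>\<^bsub>AutoGroup G\<^esub> \<beta>) x = \<alpha> (\<beta> x)"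
  using assms by (simp add: AutoGroup_def auto_def BijGroup_def compose_eq)

lemma AutoGroup_one_apply: "x \<in> carrier G \<Longrightarrow> \<one>\<^bsub>AutoGroup G\<^esub> x = x"
  by (simp add: AutoGroup_def BijGroup_def)

lemma finite_AutoGroup:
  assumes "finite (carrier G)"
  shows "finite (carrier (AutoGroup G))"
proof (rule finite_subset)
  show "carrier (AutoGroup G) \<subseteq> carrier G \<rightarrow>\<^sub>E carrier G"
    by (auto simp: carrier_AutoGroup auto_def hom_def PiE_def Bij_def)
  show "finite (carrier G \<rightarrow>\<^sub>E carrier G)" using assms by (intro finite_PiE) auto
qed

lemma (in group) inner_automorphism:
  assumes g: "g \<in> carrier G"
  shows "(\<lambda>x \<in> carrier G. g \<otimes> x \<otimes> inv g) \<in> carrier (AutoGroup G)"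
proof -
  have "(\<lambda>x \<in> carrier G. g \<otimes> x \<otimes> inv g) \<in> hom G G"
    using g conj_mult by (auto simp: hom_def)
  then show ?thesis
    using conjugation_is_bij[OF g] by (simp add: carrier_AutoGroup auto_def Bij_def)
qed

lemma (in group) AutoGroup_automorphism_action:
  "automorphism_action G (AutoGroup G) (\<lambda>\<alpha>. \<alpha>)"
proof (intro automorphism_action.intro automorphism_action_axioms.intro)
  show "\<exists>\<gamma>\<in>carrier (AutoGroup G). \<forall>x\<in>carrier G. \<gamma> x = g \<otimes> x \<otimes> inv g"
    if "g \<in> carrier G" for g
    using that by (intro bexI[OF _ inner_automorphism]) auto
qed (auto simp: AutoGroup AutoGroup_mult_apply AutoGroup_one_apply group_axioms,
     auto simp: carrier_AutoGroup auto_def hom_def)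

lemma (in automorphism_action) central_term_eq_iterated_commutators:
  "central_term n = {x \<in> carrier G. \<forall>\<gamma>s. length \<gamma>s = n \<and> set \<gamma>s \<subseteq> carrier \<Gamma> \<longrightarrow>
     foldl (\<lambda>y \<gamma>. inv y \<otimes> act \<gamma> y) x \<gamma>s = \<one>}"
proof (induction n)
  case (Suc n)
  have "x \<in> central_term (Suc n) \<longleftrightarrow>
    (\<forall>\<gamma>s. length \<gamma>s = Suc n \<and> set \<gamma>s \<subseteq> carrier \<Gamma> \<longrightarrow>
       foldl (\<lambda>y \<gamma>. inv y \<otimes> act \<gamma> y) x \<gamma>s = \<one>)" if x: "x \<in> carrier G" for x
  proof -
    have "x \<in> central_term (Suc n) \<longleftrightarrow> (\<forall>\<gamma>\<in>carrier \<Gamma>. \<forall>\<gamma>s. length \<gamma>s = n \<and> set \<gamma>s \<subseteq> carrier \<Gamma> \<longrightarrow>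
       foldl (\<lambda>y \<gamma>. inv y \<otimes> act \<gamma> y) (inv x \<otimes> act \<gamma> x) \<gamma>s = \<one>)"
      using x Suc act_closed by simp
    also have "\<dots> \<longleftrightarrow> (\<forall>\<gamma>s. length \<gamma>s = Suc n \<and> set \<gamma>s \<subseteq> carrier \<Gamma> \<longrightarrow>
       foldl (\<lambda>y \<gamma>. inv y \<otimes> act \<gamma> y) x \<gamma>s = \<one>)"
      (is "?L \<longleftrightarrow> ?R")
    proof
      show ?R if ?L using that by (auto simp: length_Suc_conv)
      show ?L if r: ?R
      proof (intro ballI allI impI)
        fix \<gamma> \<gamma>s assume "\<gamma> \<in> carrier \<Gamma>" "length \<gamma>s = n \<and> set \<gamma>s \<subseteq> carrier \<Gamma>"
        then show "foldl (\<lambda>y \<gamma>. inv y \<otimes> act \<gamma> y) (inv x \<otimes> act \<gamma> x) \<gamma>s = \<one>"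
          using spec[OF r, of "\<gamma> # \<gamma>s"] by simp
      qed
    qed
    finally show ?thesis .
  qed
  then show ?case using central_term_carrier[of "Suc n"] by blast
qed auto

lemma (in group) autonilpotent_iff:
  "autonilpotent G \<longleftrightarrow> (\<exists>n. automorphism_action.central_term G (AutoGroup G) (\<lambda>\<alpha>. \<alpha>) n = carrier G)"
proof -
  interpret A: automorphism_action G "AutoGroup G" "\<lambda>\<alpha>. \<alpha>" by (rule AutoGroup_automorphism_action)
  have "autocentral_term n G = A.central_term n" for n
    unfolding A.central_term_eq_iterated_commutators autocentral_term_def
      iterated_autocommutator_def autocommutator_def by simp
  then show ?thesis unfolding autonilpotent_def by metis
qed

lemma (in group) subgroup_aut_normalizer:
  assumes fin: "finite (carrier G)" and P: "P \<subseteq> carrier G"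
  shows "subgroup (aut_normalizer G P) (AutoGroup G)"
proof -
  interpret A: group "AutoGroup G" by (rule AutoGroup)
  show ?thesis
  proof (rule A.finite_subgroupI[OF finite_AutoGroup[OF fin]])
    show "\<one>\<^bsub>AutoGroup G\<^esub> \<in> aut_normalizer G P"
      using P by (auto simp: aut_normalizer_def AutoGroup_one_apply subset_iff image_iff)
    fix \<alpha> \<beta> assume "\<alpha> \<in> aut_normalizer G P" "\<beta> \<in> aut_normalizer G P"
    moreover from this have "(\<alpha> \<otimes>\<^bsub>AutoGroup G\<^esub> \<beta>) ` P = \<alpha> ` \<beta> ` P"
      using P unfolding image_image
      by (intro image_cong refl AutoGroup_mult_apply) (auto simp: aut_normalizer_def)
    ultimately show "\<alpha> \<otimes>\<^bsub>AutoGroup G\<^esub> \<beta> \<in> aut_normalizer G P"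
      by (simp add: aut_normalizer_def)
  qed (auto simp: aut_normalizer_def)
qed

lemma (in group) subgroup_aut_centralizer:
  assumes fin: "finite (carrier G)" and P: "P \<subseteq> carrier G"
  shows "subgroup (aut_centralizer G P) (AutoGroup G)"
proof -
  interpret A: group "AutoGroup G" by (rule AutoGroup)
  show ?thesis
    by (rule A.finite_subgroupI[OF finite_AutoGroup[OF fin]])
       (use P in \<open>auto simp: aut_centralizer_def AutoGroup_one_apply AutoGroup_mult_apply subset_iff\<close>)
qed

lemma (in group) aut_centralizer_normal:
  assumes fin: "finite (carrier G)" and P: "P \<subseteq> carrier G"
  shows "aut_centralizer G P \<lhd> (AutoGroup G)\<lparr>carrier := aut_normalizer G P\<rparr>"
proof -
  interpret A: group "AutoGroup G" by (rule AutoGroup)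
  let ?N = "aut_normalizer G P" and ?C = "aut_centralizer G P"
  have N: "subgroup ?N (AutoGroup G)" by (rule subgroup_aut_normalizer[OF fin P])
  have C: "subgroup ?C (AutoGroup G)" by (rule subgroup_aut_centralizer[OF fin P])
  interpret N: group "(AutoGroup G)\<lparr>carrier := ?N\<rparr>" using N by (rule A.subgroup_imp_group)
  have CN: "?C \<subseteq> ?N" by (auto simp: aut_centralizer_def aut_normalizer_def image_iff)
  have "\<beta> \<otimes>\<^bsub>AutoGroup G\<^esub> \<gamma> \<otimes>\<^bsub>AutoGroup G\<^esub> inv\<^bsub>AutoGroup G\<^esub> \<beta> \<in> ?C"
    if \<beta>: "\<beta> \<in> ?N" and \<gamma>: "\<gamma> \<in> ?C" for \<beta> \<gamma>
  proof -
    let ?\<delta> = "\<beta> \<otimes>\<^bsub>AutoGroup G\<^esub> \<gamma> \<otimes>\<^bsub>AutoGroup G\<^esub> inv\<^bsub>AutoGroup G\<^esub> \<beta>"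
    have A: "\<beta> \<in> carrier (AutoGroup G)" "\<gamma> \<in> carrier (AutoGroup G)"
      using \<beta> \<gamma> by (auto simp: aut_normalizer_def aut_centralizer_def)
    have "?\<delta> x = x" if "x \<in> P" for x
    proof -
      obtain y where y: "y \<in> P" "x = \<beta> y" using \<beta> \<open>x \<in> P\<close> by (auto simp: aut_normalizer_def)
      have yG: "y \<in> carrier G" using y P by blast
      have "?\<delta> (\<beta> y) = (?\<delta> \<otimes>\<^bsub>AutoGroup G\<^esub> \<beta>) y"
        using A yG by (simp add: AutoGroup_mult_apply)
      also have "?\<delta> \<otimes>\<^bsub>AutoGroup G\<^esub> \<beta> = \<beta> \<otimes>\<^bsub>AutoGroup G\<^esub> \<gamma>"
        using A by (simp add: A.m_assoc)
      also have "(\<beta> \<otimes>\<^bsub>AutoGroup G\<^esub> \<gamma>) y = \<beta> y"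
        using A yG y \<gamma> by (simp add: AutoGroup_mult_apply aut_centralizer_def)
      finally show ?thesis using y by simp
    qed
    then show ?thesis using A by (simp add: aut_centralizer_def)
  qed
  moreover have "subgroup ?C ((AutoGroup G)\<lparr>carrier := ?N\<rparr>)"
    by (rule A.subgroup_incl[OF C N CN])
  ultimately show ?thesis
    using N by (simp add: N.normal_inv_iff A.m_inv_consistent)
qed

lemma (in automorphism_action) act_pow_eq:
  assumes \<gamma>: "\<gamma> \<in> carrier \<Gamma>" and x: "x \<in> carrier G" and y: "y \<in> carrier G"
    and xy: "act \<gamma> x = x \<otimes> y" and fixed: "act \<gamma> y = y"
  shows "act (\<gamma> [^]\<^bsub>\<Gamma>\<^esub> (n::nat)) x = x \<otimes> y [^] n"
proof (induction n)
  case 0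
  then show ?case using x act_one by simp
next
  case (Suc n)
  interpret \<Gamma>: group \<Gamma> by (rule acting_group)
  have "act (\<gamma> [^]\<^bsub>\<Gamma>\<^esub> Suc n) x = act \<gamma> (act (\<gamma> [^]\<^bsub>\<Gamma>\<^esub> n) x)"
    using \<gamma> x by (simp only: \<Gamma>.nat_pow_Suc2 act_comp \<Gamma>.nat_pow_closed)
  also have "\<dots> = act \<gamma> x \<otimes> act \<gamma> (y [^] n)" using Suc \<gamma> x y by (simp add: act_mult)
  also have "act \<gamma> (y [^] n) = y [^] n"
    using group_hom.hom_nat_pow[OF act_hom[OF \<gamma>] y, of n] fixed by simp
  also have "act \<gamma> x \<otimes> y [^] n = x \<otimes> y [^] Suc n"
    using x y by (simp only: xy nat_pow_Suc2 m_assoc nat_pow_closed)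
  finally show ?case .
qed

text \<open>Induction along the series: \<open>y = [x, \<gamma>]\<close> lies one term lower and in \<open>P\<close>, so \<open>\<gamma>\<close> fixes it. Then
\<open>\<gamma> ^ m = 1\<close> gives \<open>x = x y ^ m\<close>, and the \<open>p\<close>-element \<open>y\<close> is trivial.\<close>
lemma (in automorphism_action) coprime_order_fixes_central_term:
  assumes \<gamma>: "\<gamma> \<in> carrier \<Gamma>" "\<gamma> [^]\<^bsub>\<Gamma>\<^esub> m = \<one>\<^bsub>\<Gamma>\<^esub>" "coprime p m"
    and P: "subgroup P G" "P \<subseteq> p_elements p G" and inv_P: "\<And>x. x \<in> P \<Longrightarrow> act \<gamma> x \<in> P"
    and x: "x \<in> P" "x \<in> central_term n"
  shows "act \<gamma> x = x"
  using x
proof (induction n arbitrary: x)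
  case 0
  then show ?case using \<gamma>(1) act_unit by simp
next
  case (Suc n)
  have xG: "x \<in> carrier G" using Suc.prems(1) subgroup.mem_carrier[OF P(1)] by blast
  define y where "y = inv x \<otimes> act \<gamma> x"
  have yP: "y \<in> P"
    unfolding y_def using Suc.prems(1) inv_P P(1) by (simp add: subgroup.m_closed subgroup.m_inv_closed)
  have yG: "y \<in> carrier G" by (rule subgroup.mem_carrier[OF P(1) yP])
  have "act \<gamma> y = y" using Suc.IH[OF yP] Suc.prems(2) \<gamma>(1) by (simp add: y_def)
  moreover have xy: "act \<gamma> x = x \<otimes> y"
    using xG act_closed[OF \<gamma>(1) xG] by (simp add: y_def flip: m_assoc)
  ultimately have "act (\<gamma> [^]\<^bsub>\<Gamma>\<^esub> m) x = x \<otimes> y [^] m" using act_pow_eq \<gamma>(1) xG yG by blast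
  then have "x \<otimes> y [^] m = x" using \<gamma>(2) act_one[OF xG] by simp
  then have "y [^] m = \<one>" using xG yG by (metis l_cancel_one' nat_pow_closed)
  then have "y = \<one>" using p_element_eq_one_of_coprime_power \<gamma>(3) P(2) yP by blast
  then show ?case using xy xG by simp
qed

lemma (in group) p_subgroup_p_elements:
  assumes "p_subgroup p P G"
  shows "subgroup P G" "P \<subseteq> p_elements p G"
  using assms subgroup_card_prime_power_p_elements[of P p]
  by (auto simp: p_subgroup_def p_group_def order_def)

section \<open>Autonilpotency and the local automorphism groups\<close>

text \<open>The quotient is recognized as a \<open>p\<close>-group element by element: raising \<open>\<alpha>\<close> to the \<open>p\<close>-part of the
order of the automorphism group leaves an automorphism of order prime to \<open>p\<close>, which fixes \<open>P\<close>
pointwise.\<close>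
lemma (in group) p_group_quotient_of_autonilpotent:
  assumes fin: "finite (carrier G)" and "autonilpotent G" and p: "prime p" and P: "p_subgroup p P G"
  shows "p_group p ((AutoGroup G)\<lparr>carrier := aut_normalizer G P\<rparr> Mod aut_centralizer G P)"
proof -
  interpret A: automorphism_action G "AutoGroup G" "\<lambda>\<alpha>. \<alpha>" by (rule AutoGroup_automorphism_action)
  interpret AG: group "AutoGroup G" by (rule AutoGroup)
  note P' = p_subgroup_p_elements[OF P]
  have PG: "P \<subseteq> carrier G" by (rule subgroup.subset[OF P'(1)])
  let ?N = "aut_normalizer G P" and ?C = "aut_centralizer G P"
  let ?AN = "(AutoGroup G)\<lparr>carrier := ?N\<rparr>"
  obtain n where n: "A.central_term n = carrier G"
    using \<open>autonilpotent G\<close> autonilpotent_iff by blast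
  have N: "subgroup ?N (AutoGroup G)" by (rule subgroup_aut_normalizer[OF fin PG])
  interpret C: normal ?C ?AN by (rule aut_centralizer_normal[OF fin PG])
  interpret Q: group "?AN Mod ?C" by (rule C.factorgroup_is_group)
  have finN: "finite ?N"
    using finite_subset[OF subgroup.subset[OF N] finite_AutoGroup[OF fin]] .
  have finQ: "finite (carrier (?AN Mod ?C))"
    using finN by (simp add: FactGroup_def RCOSETS_def)
  have "carrier (?AN Mod ?C) \<subseteq> p_elements p (?AN Mod ?C)"
  proof
    fix X assume X: "X \<in> carrier (?AN Mod ?C)"
    then obtain \<alpha> where \<alpha>: "\<alpha> \<in> ?N" "X = ?C #>\<^bsub>?AN\<^esub> \<alpha>"
      by (auto simp: FactGroup_def RCOSETS_def)
    have \<alpha>A: "\<alpha> \<in> carrier (AutoGroup G)" using \<alpha> by (simp add: aut_normalizer_def)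
    have "order (AutoGroup G) \<noteq> 0"
      using finite_AutoGroup[OF fin] AG.order_gt_0_iff_finite by simp
    then obtain k m where m: "order (AutoGroup G) = p ^ k * m" "\<not> p dvd m"
      using multiplicity_decompose'[of "order (AutoGroup G)" p] p not_prime_unit by blast
    let ?\<beta> = "\<alpha> [^]\<^bsub>AutoGroup G\<^esub> (p ^ k)"
    have \<beta>N: "?\<beta> \<in> ?N" by (rule AG.subgroup_nat_pow_closed[OF N \<alpha>(1)])
    have "?\<beta> [^]\<^bsub>AutoGroup G\<^esub> m = \<one>\<^bsub>AutoGroup G\<^esub>"
      using \<alpha>A AG.pow_order_eq_1[OF \<alpha>A] m(1) by (simp add: AG.nat_pow_pow)
    moreover have "coprime p m" using p m(2) prime_imp_coprime by blast
    moreover have "?\<beta> ` P = P" using \<beta>N by (simp add: aut_normalizer_def)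
    then have "?\<beta> x \<in> P" if "x \<in> P" for x using that by blast
    ultimately have "?\<beta> x = x" if "x \<in> P" for x
      using A.coprime_order_fixes_central_term[of ?\<beta> m p P x n] \<alpha>A P' that PG n by blast
    then have "?\<beta> \<in> ?C" using \<alpha>A by (simp add: aut_centralizer_def)
    then have "?C #>\<^bsub>?AN\<^esub> (\<alpha> [^]\<^bsub>?AN\<^esub> (p ^ k)) = ?C"
      using \<beta>N C.rcos_const[OF C.is_group] by (simp add: nat_pow_def)
    then have "X [^]\<^bsub>?AN Mod ?C\<^esub> (p ^ k) = \<one>\<^bsub>?AN Mod ?C\<^esub>"
      using \<alpha> C.FactGroup_pow[of \<alpha> "p ^ k"] by (simp add: FactGroup_def)
    then show "X \<in> p_elements p (?AN Mod ?C)" using X by (auto simp: p_elements_def)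
  qed
  then show ?thesis
    using Q.order_prime_power_of_p_elements[OF finQ p] p Q.group_axioms by (simp add: p_group_def)
qed

text \<open>The image of \<open>\<alpha>\<close> in the \<open>p\<close>-group \<open>N(P) / C(P)\<close> is a \<open>q\<close>-element, hence trivial. The hypothesis
speaks only of primes dividing the order of \<open>G\<close>; for other \<open>p\<close> the subgroup \<open>P\<close> is trivial.\<close>
lemma (in group) p'_automorphism_fixes_p_subgroup:
  assumes fin: "finite (carrier G)"
    and quot: "\<forall>p \<in> group_primes G. \<forall>P. p_subgroup p P G \<longrightarrow>
       p_group p ((AutoGroup G)\<lparr>carrier := aut_normalizer G P\<rparr> Mod aut_centralizer G P)"
    and pq: "prime p" "prime q" "q \<noteq> p"
    and P: "subgroup P G" "P \<subseteq> p_elements p G"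
    and \<alpha>: "\<alpha> \<in> p_elements q (AutoGroup G)" "\<alpha> ` P = P" and x: "x \<in> P"
  shows "\<alpha> x = x"
proof -
  interpret A: automorphism_action G "AutoGroup G" "\<lambda>\<alpha>. \<alpha>" by (rule AutoGroup_automorphism_action)
  interpret AG: group "AutoGroup G" by (rule AutoGroup)
  interpret P: group "G\<lparr>carrier := P\<rparr>" using P(1) by (rule subgroup_imp_group)
  have PG: "P \<subseteq> carrier G" by (rule subgroup.subset[OF P(1)])
  have finP: "finite P" by (rule finite_subset[OF PG fin])
  have \<alpha>A: "\<alpha> \<in> carrier (AutoGroup G)" using \<alpha>(1) by (simp add: p_elements_def)
  have "P \<subseteq> p_elements p (G\<lparr>carrier := P\<rparr>)" using P by (simp add: p_elements_subgroup)
  then obtain k where k: "card P = p ^ k"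
    using P.order_prime_power_of_p_elements[OF _ pq(1)] finP by (auto simp: order_def)
  show ?thesis
  proof (cases "k = 0")
    case True
    then have "card P = 1" using k by simp
    then have "P = {\<one>}" using subgroup.one_closed[OF P(1)] by (metis card_1_singletonE singletonD)
    then show ?thesis using x A.act_unit[OF \<alpha>A] by simp
  next
    case False
    then have "p dvd card P" using k by simp
    moreover have "card P dvd order G"
      using lagrange[OF P(1)] by (metis dvd_triv_right)
    ultimately have "p \<in> group_primes G"
      using pq(1) fin order_gt_0_iff_finite dvd_trans
      by (auto simp: group_primes_def prime_factors_dvd)
    moreover have "p_subgroup p P G"
      using P(1) pq(1) k P.group_axioms by (auto simp: p_subgroup_def p_group_def order_def)
    ultimately have Q: "p_group p ((AutoGroup G)\<lparr>carrier := aut_normalizer G P\<rparr> Mod aut_centralizer G P)"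
      using quot by blast
    let ?N = "aut_normalizer G P" and ?C = "aut_centralizer G P"
    let ?AN = "(AutoGroup G)\<lparr>carrier := ?N\<rparr>"
    interpret C: normal ?C ?AN by (rule aut_centralizer_normal[OF fin PG])
    obtain j where j: "card (rcosets\<^bsub>?AN\<^esub> ?C) = p ^ j"
      using Q by (auto simp: p_group_def order_def FactGroup_def)
    have \<alpha>N: "\<alpha> \<in> ?N" using \<alpha>A \<alpha>(2) by (simp add: aut_normalizer_def)
    have "\<alpha> \<in> p_elements q ?AN"
      using \<alpha>(1) \<alpha>N by (simp add: p_elements_subgroup[OF subgroup_aut_normalizer[OF fin PG]])
    moreover have "\<alpha> [^]\<^bsub>?AN\<^esub> (p ^ j) \<in> ?C" using C.pow_index_mem[of \<alpha>] \<alpha>N j by simp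
    moreover have "coprime q (p ^ j)" using pq by (simp add: primes_coprime)
    ultimately have "\<alpha> \<in> ?C"
      using C.p_element_mem_of_coprime_power[OF C.subgroup_axioms] by blast
    then show ?thesis using x by (simp add: aut_centralizer_def)
  qed
qed

text \<open>The inner automorphism induced by a \<open>q\<close>-element is therefore a \<open>q\<close>-element.\<close>
lemma (in group) inner_automorphism_pow:
  assumes g: "g \<in> carrier G"
  shows "(\<lambda>x \<in> carrier G. g \<otimes> x \<otimes> inv g) [^]\<^bsub>AutoGroup G\<^esub> (n::nat)
    = (\<lambda>x \<in> carrier G. g [^] n \<otimes> x \<otimes> inv (g [^] n))"
proof (induction n)
  case 0
  show ?case by (auto simp: AutoGroup_def BijGroup_def)
next
  case (Suc n)
  show ?case
  proof (rule extensionalityI[of _ "carrier G"])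
    have "(\<lambda>x \<in> carrier G. g \<otimes> x \<otimes> inv g) [^]\<^bsub>AutoGroup G\<^esub> Suc n \<in> carrier (AutoGroup G)"
      using group.is_monoid[OF AutoGroup] inner_automorphism[OF g] by (rule monoid.nat_pow_closed)
    then show "(\<lambda>x \<in> carrier G. g \<otimes> x \<otimes> inv g) [^]\<^bsub>AutoGroup G\<^esub> Suc n \<in> extensional (carrier G)"
      by (simp add: carrier_AutoGroup auto_def Bij_def del: nat_pow_Suc)
    fix x assume x: "x \<in> carrier G"
    have "g [^] n \<in> carrier G" using g by simp
    with x show "((\<lambda>x \<in> carrier G. g \<otimes> x \<otimes> inv g) [^]\<^bsub>AutoGroup G\<^esub> Suc n) x
      = (\<lambda>x \<in> carrier G. g [^] Suc n \<otimes> x \<otimes> inv (g [^] Suc n)) x"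
      using g
      by (simp only: Group.nat_pow_Suc Suc AutoGroup_mult_apply inner_automorphism)
         (simp add: conj_conj)
  qed (rule restrict_extensional)
qed

text \<open>The hypothesis is used twice: for inner automorphisms, to see that \<open>G\<close> is nilpotent, and then for
all automorphisms acting on the characteristic subgroups of \<open>p\<close>-elements.\<close>
lemma (in group) autonilpotent_of_p_group_quotients:
  assumes fin: "finite (carrier G)"
    and quot: "\<forall>p \<in> group_primes G. \<forall>P. p_subgroup p P G \<longrightarrow>
       p_group p ((AutoGroup G)\<lparr>carrier := aut_normalizer G P\<rparr> Mod aut_centralizer G P)"
  shows "autonilpotent G"
proof -
  interpret A: automorphism_action G "AutoGroup G" "\<lambda>\<alpha>. \<alpha>" by (rule AutoGroup_automorphism_action)
  interpret AG: group "AutoGroup G" by (rule AutoGroup)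
  \<comment> \<open>An automorphism mapping a finite set into itself maps it onto itself.\<close>
  have bij: "\<alpha> ` P = P"
    if \<alpha>: "\<alpha> \<in> carrier (AutoGroup G)" and P: "P \<subseteq> carrier G" and sub: "\<alpha> ` P \<subseteq> P" for \<alpha> P
  proof -
    have "inj_on \<alpha> P"
      using \<alpha> P by (auto simp: carrier_AutoGroup auto_def Bij_def bij_betw_def intro: inj_on_subset)
    moreover have "finite P" by (rule finite_subset[OF P fin])
    ultimately show ?thesis using sub by (simp add: endo_inj_surj)
  qed
  have "p_local_centralizing G"
    unfolding p_local_centralizing_def
  proof (intro allI impI ballI)
    fix p q :: nat and P g x
    assume pq: "prime p" "prime q" "p \<noteq> q" and P: "subgroup P G" "P \<subseteq> p_elements p G"
      and g: "g \<in> p_elements q G \<inter> normalizing G P" and x: "x \<in> P"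
    have PG: "P \<subseteq> carrier G" by (rule subgroup.subset[OF P(1)])
    obtain k where gG: "g \<in> carrier G" and k: "g [^] (q ^ k) = \<one>"
      using g by (auto simp: p_elements_def)
    let ?\<alpha> = "\<lambda>x \<in> carrier G. g \<otimes> x \<otimes> inv g"
    have \<alpha>: "?\<alpha> \<in> carrier (AutoGroup G)" by (rule inner_automorphism[OF gG])
    have "?\<alpha> [^]\<^bsub>AutoGroup G\<^esub> (q ^ k) = \<one>\<^bsub>AutoGroup G\<^esub>"
      unfolding inner_automorphism_pow[OF gG] k by (auto simp: AutoGroup_def BijGroup_def)
    then have "?\<alpha> \<in> p_elements q (AutoGroup G)" using \<alpha> by (auto simp: p_elements_def)
    moreover have "?\<alpha> ` P = P"
      using g PG by (intro bij[OF \<alpha> PG]) (auto simp: normalizing_def)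
    ultimately have "?\<alpha> x = x"
      using p'_automorphism_fixes_p_subgroup[OF fin quot pq(1,2) _ P] pq(3) x by blast
    then have "g \<otimes> x \<otimes> inv g = x" using x PG by auto
    then show "g \<otimes> x = x \<otimes> g" using gG x PG by (metis inv_solve_right m_closed subsetD)
  qed
  then have cc: "coprime_commuting G"
    using coprime_commuting_of_p_local_centralizing fin group_axioms by blast
  have "\<exists>n. A.central_term n = carrier G"
  proof (rule A.central_term_eq_carrier[OF fin finite_AutoGroup[OF fin]])
    show sub: "subgroup (p_elements p G) G" if "prime p" for p
      using that by (rule subgroup_p_elements[OF fin cc])
    fix p q \<gamma> x
    assume pq: "prime p" "prime q" "q \<noteq> p" and \<gamma>: "\<gamma> \<in> p_elements q (AutoGroup G)"
      and x: "x \<in> p_elements p G"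
    have \<gamma>A: "\<gamma> \<in> carrier (AutoGroup G)" using \<gamma> by (simp add: p_elements_def)
    have "\<gamma> ` p_elements p G = p_elements p G"
      using A.act_p_elements[OF \<gamma>A] by (intro bij[OF \<gamma>A]) (auto simp: p_elements_def)
    then show "\<gamma> x = x"
      using p'_automorphism_fixes_p_subgroup[OF fin quot pq sub[OF pq(1)] _ \<gamma>] x by blast
  qed
  then show ?thesis using autonilpotent_iff by blast
qed

theorem theorem1p4:
  fixes G (structure)
  assumes "group G" and "finite (carrier G)"
  shows "autonilpotent G \<longleftrightarrow>
    (\<forall>p \<in> group_primes G. \<forall>P. p_subgroup p P G \<longrightarrow>
       p_group p ((AutoGroup G)\<lparr>carrier := aut_normalizer G P\<rparr> Mod aut_centralizer G P))"
proof
  assume "autonilpotent G"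
  then show "\<forall>p \<in> group_primes G. \<forall>P. p_subgroup p P G \<longrightarrow>
       p_group p ((AutoGroup G)\<lparr>carrier := aut_normalizer G P\<rparr> Mod aut_centralizer G P)"
    using group.p_group_quotient_of_autonilpotent[OF assms] by (auto simp: group_primes_def)
next
  assume "\<forall>p \<in> group_primes G. \<forall>P. p_subgroup p P G \<longrightarrow>
       p_group p ((AutoGroup G)\<lparr>carrier := aut_normalizer G P\<rparr> Mod aut_centralizer G P)"
  then show "autonilpotent G" by (rule group.autonilpotent_of_p_group_quotients[OF assms])
qed

end
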